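(* For every $C_0<\infty$ there is a constant $C<\infty$, depending only on $C_0$, such that the following holds. Let $\beta\in[0,\infty)$ and suppose the candidate-ability distribution $F$ is $(\beta,\varepsilon_0=1,\delta=0)$-clustered with constant $C_0$ (so $F$ has no non-trivial gaps). Then for the multisecretary problem, for all $T\in\mathbb N$ and all $B\in[T]$, $$\mathrm{Regret}(B,T;\mathrm{CwG})\le C\Big(1+\frac1\beta\Big)T^{\frac12-\frac{1}{2(1+\beta)}}\,\mathbf 1\{\beta>0\}+C\log T\,\mathbf 1\{\beta=0\}.$$
   Context: Multisecretary problem: horizon $T\in\mathbb N$, hiring budget $B\in[T]=\{1,\dots,T\}$. Abilities $\theta_1,\dots,\theta_T\in[0,1]$ are i.i.d. from a known distribution with CDF $F$. At each time $t$, after observing $\theta_t$, the decision maker irrevocably accepts ($a_t=1$) or rejects ($a_t=0$); at most $B$ acceptances in total; policies may be randomized and must be non-anticipating. $\mathrm{Regret}(B,T;\pi)=\mathbb E\big[\max\{\sum_t\theta_t a_t:a\in\{0,1\}^T,\sum_t a_t\le B\}\big]-\mathbb E[\sum_t\theta_t a_t^\pi]$. Let $F^{-1}(q)=\inf\{v:F(v)\ge q\}$. In general $F$ is $(\beta,\varepsilon_0,\delta)$-clustered with constant $C_0$ if there are gap quantiles $q_0^\star=0<q_1^\star<\dots<q_n^\star<q_{n+1}^\star=1$ ($n\ge0$) with $|F^{-1}(q)-F^{-1}(\tilde q)|\le C_0|q-\tilde q|^{1/(\beta+1)}+\delta$ for all $q,\tilde q$ in a common interval $(q_{i-1}^\star,q_i^\star]$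 and $q_i^\star-q_{i-1}^\star\ge\varepsilon_0$ for all $i$. For $\varepsilon_0=1,\delta=0$ this forces $n=0$ and says $|F^{-1}(q)-F^{-1}(\tilde q)|\le C_0|q-\tilde q|^{1/(\beta+1)}$ for all $q,\tilde q\in(0,1]$. CwG policy when $\varepsilon_0=1$ (no gap quantiles): set $B_1=B$; for $t=1,\dots,T$ let $p_t=1-\frac{B_t}{T-t+1}$, observe $\theta_t$, and draw $X_t$ uniformly at random from $\{q\in[0,1]:F^{-1}(q)=\theta_t\}$ (its unique element if a singleton); if $X_t\ge p_t$ and $B_t>0$, accept and set $B_{t+1}=B_t-1$, otherwise reject and set $B_{t+1}=B_t$. *)

theory Defs
  imports "HOL-Probability.Probability"
begin

text \<open>
  The ability distribution is a Borel probability measure \<open>D\<close> on the reals that is concentrated on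
  the unit interval; its CDF is \<^term>\<open>cdf D\<close>. Periods are numbered \<open>1, \<dots>, T\<close>.
\<close>

text \<open>
  The infimum is over the ability range, so that \<open>quantile D 0 = 0\<close>
  (over all reals the set would be unbounded below for \<open>q = 0\<close>).
\<close>
definition quantile :: "real measure \<Rightarrow> real \<Rightarrow> real" where
  "quantile D q = Inf {v \<in> {0..1}. cdf D v \<ge> q}"

definition clustered :: "real \<Rightarrow> real \<Rightarrow> real \<Rightarrow> real \<Rightarrow> real measure \<Rightarrow> bool" where
  "clustered \<beta> \<epsilon>\<^sub>0 \<delta> C\<^sub>0 D \<longleftrightarrow>
     (\<exists>(n::nat) (qs :: nat \<Rightarrow> real).
        qs 0 = 0 \<and> qs (n + 1) = 1 \<and>
        (\<forall>i\<in>{1..n + 1}.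
           qs (i - 1) < qs i \<and>
           qs i - qs (i - 1) \<ge> \<epsilon>\<^sub>0 \<and>
           (\<forall>q\<in>{qs (i - 1)<..qs i}. \<forall>q'\<in>{qs (i - 1)<..qs i}.
              \<bar>quantile D q - quantile D q'\<bar> \<le> C\<^sub>0 * \<bar>q - q'\<bar> powr (1 / (\<beta> + 1)) + \<delta>)))"

definition offline_reward :: "nat \<Rightarrow> nat \<Rightarrow> (nat \<Rightarrow> real) \<Rightarrow> real" where
  "offline_reward T B \<theta> =
     Max ((\<lambda>a. \<Sum>t=1..T. \<theta> t * real (a t)) `
       {a \<in> {1..T} \<rightarrow>\<^sub>E {0, 1::nat}. (\<Sum>t=1..T. a t) \<le> B})"

definition regret ::
  "'w measure \<Rightarrow> nat \<Rightarrow> nat \<Rightarrow> (nat \<Rightarrow> 'w \<Rightarrow> real) \<Rightarrow> (nat \<Rightarrow> 'w \<Rightarrow> nat) \<Rightarrow> real" where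
  "regret M T B \<theta> a =
     (\<integral>\<omega>. offline_reward T B (\<lambda>t. \<theta> t \<omega>) \<partial>M) - (\<integral>\<omega>. (\<Sum>t=1..T. \<theta> t \<omega> * real (a t \<omega>)) \<partial>M)"

text \<open>
  Only used for level sets of the quantile function in the unit interval. These are intervals, so a
  null one is a singleton (whose element is returned) or empty. The latter happens only for
  abilities in a null set of \<open>D\<close>, where the value is irrelevant.
\<close>
definition uniform_draw :: "real set \<Rightarrow> real measure" where
  "uniform_draw S =
     (if emeasure lborel S = 0 then return borel (THE q. q \<in> S) else uniform_measure lborel S)"

text \<open>Joint law of one period's ability and the policy's randomized quantile of it.\<close>
definition period_law :: "real measure \<Rightarrow> (real \<times> real) measure" where
  "period_law D =
     do {
       \<theta> \<leftarrow> D;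
       x \<leftarrow> uniform_draw {q \<in> {0..1}. quantile D q = \<theta>};
       return (borel \<Otimes>\<^sub>M borel) (\<theta>, x)
     }"

definition sample_space :: "real measure \<Rightarrow> nat \<Rightarrow> (nat \<Rightarrow> real \<times> real) measure" where
  "sample_space D T = (\<Pi>\<^sub>M t\<in>{1..T}. period_law D)"

definition ability :: "nat \<Rightarrow> (nat \<Rightarrow> real \<times> real) \<Rightarrow> real" where
  "ability t \<omega> = fst (\<omega> t)"

definition drawn_quantile :: "nat \<Rightarrow> (nat \<Rightarrow> real \<times> real) \<Rightarrow> real" where
  "drawn_quantile t \<omega> = snd (\<omega> t)"

definition cwg_threshold :: "nat \<Rightarrow> nat \<Rightarrow> nat \<Rightarrow> real" where
  "cwg_threshold T t b = 1 - real b / (real T - real t + 1)"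

definition cwg_accepts :: "nat \<Rightarrow> nat \<Rightarrow> nat \<Rightarrow> real \<Rightarrow> bool" where
  "cwg_accepts T t b x \<longleftrightarrow> x \<ge> cwg_threshold T t b \<and> b > 0"

text \<open>
  Remaining budget at the beginning of a period, along the sequence \<open>x\<close> of drawn quantiles.
  Period 0 is a dummy in which nothing happens, so that the budget in period 1 is \<open>B\<close>.
\<close>
primrec cwg_budget :: "nat \<Rightarrow> nat \<Rightarrow> (nat \<Rightarrow> real) \<Rightarrow> nat \<Rightarrow> nat" where
  "cwg_budget T B x 0 = B"
| "cwg_budget T B x (Suc t) =
     (if t \<ge> 1 \<and> cwg_accepts T t (cwg_budget T B x t) (x t)
      then cwg_budget T B x t - 1 else cwg_budget T B x t)"

definition cwg_action :: "nat \<Rightarrow> nat \<Rightarrow> nat \<Rightarrow> (nat \<Rightarrow> real \<times> real) \<Rightarrow> nat" where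
  "cwg_action T B t \<omega> =
     (let x = (\<lambda>s. drawn_quantile s \<omega>)
      in if cwg_accepts T t (cwg_budget T B x t) (x t) then 1 else 0)"

definition cwg_regret :: "real measure \<Rightarrow> nat \<Rightarrow> nat \<Rightarrow> real" where
  "cwg_regret D B T = regret (sample_space D T) T B ability (cwg_action T B)"

end

theory Submission
  imports Defs
begin

text \<open>
  Why the bound holds. Drawing \<open>\<theta>\<close> from the ability distribution and then a quantile uniformly from
  the level set of \<open>\<theta>\<close> amounts to drawing one uniform variable \<open>u\<close> and taking the pair
  \<open>(Q u, u)\<close>, where \<open>Q\<close> is the quantile function (\<open>period_law_eq_distr\<close>). So the problem is driven
  by i.i.d. uniform variables, and the policy accepts \<open>u\<close> when it exceeds the threshold
  \<open>p = 1 - b / (n + 1)\<close>, with \<open>b\<close> the remaining budget and \<open>n\<close> the number of periods still to come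
  after the current one.

  Compare the policy with the hindsight optimum one period at a time. Among the \<open>n\<close> future abilities
  the marginal hindsight value of the \<open>b\<close>-th unit of budget is \<open>Q Y\<close>, where the cutoff quantile \<open>Y\<close>
  is the \<open>b\<close>-th largest of the \<open>n\<close> future uniform variables (\<open>marginal_value_eq_cutoff\<close>). Accepting
  \<open>u\<close> is a mistake only if \<open>p \<le> u < Y\<close>, rejecting it only if \<open>Y < u < p\<close>, and the mistake costs
  \<open>\<bar>Q Y - Q u\<bar>\<close>, which is at most \<open>C \<bar>Y - p\<bar>\<^sup>s\<close> with \<open>s = 1 / (\<beta> + 1)\<close> since \<open>u\<close> lies between
  \<open>p\<close> and \<open>Y\<close> (\<open>cwg_loss_le\<close>). As \<open>u\<close> is independent of \<open>Y\<close>, this event has conditional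
  probability at most \<open>\<bar>Y - p\<bar>\<close>, so the expected loss of the period is at most
  \<open>C E \<bar>Y - p\<bar>\<^bsup>1 + s\<^esup>\<close>.

  The threshold is exactly the mean of \<open>Y\<close>, which has a Beta law, and its variance is at most
  \<open>1 / (n + 1)\<close> (\<open>cutoff_variance_le\<close>). Hence the expected loss is at most
  \<open>2 C (n + 1) powr (- (1 + s) / 2)\<close>, uniformly in the budget that the policy happens to have, and it
  vanishes in the last period, where the policy is optimal (\<open>expected_cwg_loss_le\<close>). Summing over the
  periods (\<open>expected_path_regret_le\<close>) gives a sum of \<open>k powr (- a)\<close> over \<open>2 \<le> k \<le> T\<close> with
  \<open>a = (1 + s) / 2\<close>; it is at most \<open>ln T\<close> for \<open>\<beta> = 0\<close>, where \<open>a = 1\<close>, and at most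
  \<open>T powr (1 - a) / (1 - a)\<close> for \<open>\<beta> > 0\<close>, where \<open>1 / (1 - a) = 2 (1 + 1 / \<beta>)\<close>.
\<close>

section \<open>Ability and drawn quantile as functions of one uniform variable\<close>

text \<open>
  The open interval keeps the draws away from \<open>0\<close>, where the quantile function may jump although it
  is Hoelder continuous on \<open>(0, 1]\<close>.
\<close>
definition unif :: "real measure" where
  "unif = uniform_measure lborel {0<..<1}"

lemma sets_unif [simp, measurable_cong]: "sets unif = sets borel"
  by (simp add: unif_def)

lemma space_unif [simp]: "space unif = UNIV"
  by (simp add: unif_def)

lemma prob_space_unif: "prob_space unif"
  unfolding unif_def by (rule prob_space_uniform_measure) auto

lemma emeasure_unif: "A \<in> sets borel \<Longrightarrow> emeasure unif A = emeasure lborel ({0<..<1} \<inter> A)"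
  by (simp add: unif_def divide_ennreal_def)

lemma AE_unif: "AE u in unif. u \<in> {0<..<1}"
  unfolding unif_def by (rule AE_uniform_measureI) auto

locale unit_ability = real_distribution D for D :: "real measure" +
  assumes AE_ability: "AE \<theta> in D. \<theta> \<in> {0..1}"
begin

lemma cdf_eq_0: "v < 0 \<Longrightarrow> cdf D v = 0"
  using AE_ability unfolding cdf_def by (subst prob_eq_0) auto

lemma cdf_eq_1: "1 \<le> v \<Longrightarrow> cdf D v = 1"
  using AE_ability unfolding cdf_def by (subst prob_eq_1) auto

text \<open>
  The Galois connection between quantile function and CDF: right continuity of the CDF makes the
  infimum in the definition of the quantile attained.
\<close>
lemma quantile_le_iff:
  assumes "q \<le> 1" "v \<in> {0..1}"
  shows "quantile D q \<le> v \<longleftrightarrow> q \<le> cdf D v"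
proof
  let ?S = "{v \<in> {0..1}. cdf D v \<ge> q}"
  have ne: "?S \<noteq> {}" and bd: "bdd_below ?S"
    using assms cdf_eq_1[of 1] by (auto intro!: exI[of _ 1] bdd_belowI[of _ 0])
  show "quantile D q \<le> v" if "q \<le> cdf D v"
    unfolding quantile_def using that assms bd by (intro cInf_lower) auto
  show "q \<le> cdf D v" if "quantile D q \<le> v"
  proof (rule tendsto_lowerbound)
    show "(cdf D \<longlongrightarrow> cdf D v) (at_right v)"
      using cdf_is_right_cont[of v] by (simp add: continuous_within)
    show "\<forall>\<^sub>F w in at_right v. q \<le> cdf D w"
    proof (rule eventually_at_right_less[THEN eventually_mono])
      fix w assume "v < w"
      then have "Inf ?S < w" using that by (simp add: quantile_def)
      then obtain z where "z \<in> ?S" "z < w" using cInf_lessD[OF ne] by blast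
      then show "q \<le> cdf D w" using cdf_nondecreasing[of z w] by auto
    qed
  qed auto
qed

lemma quantile_unit: "q \<le> 1 \<Longrightarrow> quantile D q \<in> {0..1}"
proof -
  assume q: "q \<le> 1"
  have "quantile D q \<le> 1" using q quantile_le_iff[of q 1] cdf_eq_1[of 1] by auto
  moreover have "0 \<le> quantile D q"
    unfolding quantile_def using q cdf_eq_1[of 1] by (intro cInf_greatest) auto
  ultimately show ?thesis by auto
qed

lemma quantile_mono: "q \<le> q' \<Longrightarrow> q' \<le> 1 \<Longrightarrow> quantile D q \<le> quantile D q'"
  using quantile_le_iff[of q "quantile D q'"] quantile_le_iff[of q' "quantile D q'"] quantile_unit[of q']
  by auto

text \<open>
  This value at \<open>0\<close>, which may lie below the support, lets the cutoff quantile \<open>0\<close> stand for budget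
  beyond the number of remaining candidates, which is worth nothing.
\<close>
lemma quantile_0: "quantile D 0 = 0"
  using quantile_le_iff[of 0 0] quantile_unit[of 0] cdf_nonneg[of 0] by auto

lemma measurable_quantile [measurable]: "quantile D \<in> borel_measurable borel"
proof -
  have const: "quantile D q = Inf {}" if "q > 1" for q
  proof -
    have "cdf D v < q" for v using that cdf_bounded_prob[of v] by linarith
    then have "{v \<in> {0..1}. cdf D v \<ge> q} = {}" by (auto simp: not_le)
    then show ?thesis unfolding quantile_def by (simp only:)
  qed
  have [measurable]: "(\<lambda>q. quantile D (min q 1)) \<in> borel_measurable borel"
    by (intro borel_measurable_mono monoI quantile_mono) auto
  have "quantile D = (\<lambda>q. if q \<le> 1 then quantile D (min q 1) else Inf {})"
    using const by auto
  moreover have "(\<lambda>q. if q \<le> 1 then quantile D (min q 1) else Inf {}) \<in> borel_measurable borel"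
    by measurable
  ultimately show ?thesis by simp
qed

lemma distr_quantile: "distr unif borel (quantile D) = D"
proof (rule cdf_unique)
  interpret U: prob_space unif by (rule prob_space_unif)
  have [measurable]: "quantile D \<in> measurable unif borel" by measurable
  show "real_distribution (distr unif borel (quantile D))"
    by (intro U.real_distribution_distr) measurable
  show "cdf (distr unif borel (quantile D)) = cdf D"
  proof
    fix v
    have "cdf (distr unif borel (quantile D)) v = measure unif (quantile D -` {..v})"
      by (simp add: cdf_def measure_distr)
    also have "\<dots> = measure lborel ({0<..<1} \<inter> quantile D -` {..v})"
      using measurable_sets_borel[OF measurable_quantile, of "{..v}"]
      by (simp add: measure_def emeasure_unif)
    also have "\<dots> = cdf D v"
    proof -
      consider "v < 0" | "v > 1" | "v \<in> {0..1}" by fastforce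
      then show ?thesis
      proof cases
        case 1
        have "q < 1 \<Longrightarrow> \<not> quantile D q \<le> v" for q using quantile_unit[of q] 1 by auto
        then have "{0<..<1} \<inter> quantile D -` {..v} = {}"
          by auto
        then show ?thesis using 1 cdf_eq_0[of v] by simp
      next
        case 2
        have "q \<le> 1 \<Longrightarrow> quantile D q \<le> v" for q using quantile_unit[of q] 2 by auto
        then have "{0<..<1} \<inter> quantile D -` {..v} = {0<..<1}" by auto
        then show ?thesis using 2 cdf_eq_1[of v] by simp
      next
        case 3
        have "{0<..<1} \<inter> quantile D -` {..v} = {0<..<1} \<inter> {..cdf D v}"
          using quantile_le_iff[OF _ 3] by auto
        also have "measure lborel \<dots> = cdf D v"
        proof (cases "cdf D v = 1")
          case True
          then have "{0<..<1} \<inter> {..cdf D v} = {0<..<1}" by auto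
          then show ?thesis by (simp add: True)
        next
          case False
          with cdf_bounded_prob[of v] have "{0<..<1} \<inter> {..cdf D v} = {0<..cdf D v}" by auto
          then show ?thesis using cdf_nonneg[of v] by simp
        qed
        finally show ?thesis .
      qed
    qed
    finally show "cdf (distr unif borel (quantile D)) v = cdf D v" .
  qed
qed (rule real_distribution_axioms)

definition level :: "real \<Rightarrow> real set" where
  "level \<theta> = {q \<in> {0..1}. quantile D q = \<theta>}"

lemma mem_level_iff [simp]: "q \<in> level \<theta> \<longleftrightarrow> 0 \<le> q \<and> q \<le> 1 \<and> quantile D q = \<theta>"
  by (auto simp: level_def)

lemma measurable_level [measurable]: "level \<theta> \<in> sets borel"
  unfolding level_def by measurable

lemma level_between: "q \<in> level \<theta> \<Longrightarrow> q' \<in> level \<theta> \<Longrightarrow> {q..q'} \<subseteq> level \<theta>"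
proof
  fix r assume "q \<in> level \<theta>" "q' \<in> level \<theta>" "r \<in> {q..q'}"
  then show "r \<in> level \<theta>" using quantile_mono[of q r] quantile_mono[of r q'] by auto
qed

lemma emeasure_level_le: "emeasure lborel (level \<theta>) \<le> 1"
proof -
  have "emeasure lborel (level \<theta>) \<le> emeasure lborel {0..1::real}"
    by (intro emeasure_mono) auto
  then show ?thesis by simp
qed

text \<open>Level sets are convex, so two distinct elements span an interval of positive length.\<close>
lemma level_null_unique:
  assumes "emeasure lborel (level \<theta>) = 0" "q \<in> level \<theta>" "q' \<in> level \<theta>"
  shows "q = q'"
proof -
  have le: "q2 \<le> q1" if "q1 \<in> level \<theta>" "q2 \<in> level \<theta>" for q1 q2
  proof (rule ccontr)
    assume "\<not> q2 \<le> q1"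
    moreover have "emeasure lborel {q1..q2} \<le> emeasure lborel (level \<theta>)"
      using level_between[OF that] by (intro emeasure_mono) auto
    ultimately show False using assms(1) by simp
  qed
  from le[OF assms(2,3)] le[OF assms(3,2)] show ?thesis by simp
qed

lemma cdf_mem_level: "q \<in> level \<theta> \<Longrightarrow> cdf D \<theta> \<in> level \<theta>"
proof -
  assume q: "q \<in> level \<theta>"
  then have \<theta>: "\<theta> \<in> {0..1}" using quantile_unit[of q] by auto
  then have "q \<le> cdf D \<theta>" using q quantile_le_iff[of q \<theta>] by auto
  moreover have "cdf D \<theta> \<le> 1" by (rule cdf_bounded_prob)
  moreover have "quantile D (cdf D \<theta>) \<le> \<theta>" using \<theta> by (subst quantile_le_iff) (auto simp: cdf_bounded_prob)
  ultimately show ?thesis using quantile_mono[of q "cdf D \<theta>"] q cdf_nonneg[of \<theta>] by auto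
qed

text \<open>
  Away from the atoms of the distribution the draw is deterministic and can be written with the CDF;
  this form is visibly measurable in \<open>\<theta>\<close>.
\<close>
lemma uniform_draw_level_null:
  assumes "emeasure lborel (level \<theta>) = 0"
  shows "uniform_draw (level \<theta>) = return borel
    (if \<theta> \<in> {0..1} \<and> quantile D (cdf D \<theta>) = \<theta> then cdf D \<theta> else (THE q. False))"
proof (cases "level \<theta> = {}")
  case True
  then have "\<not> (\<theta> \<in> {0..1} \<and> quantile D (cdf D \<theta>) = \<theta>)"
    using cdf_bounded_prob[of \<theta>] cdf_nonneg[of \<theta>] by auto
  moreover have "(THE q. q \<in> level \<theta>) = (THE q. False)" using True by (simp only: empty_iff)
  ultimately show ?thesis using assms by (simp only: uniform_draw_def if_True if_False refl)
next
  case False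
  then obtain q where q: "q \<in> level \<theta>" by blast
  note c = cdf_mem_level[OF q]
  have "(THE q. q \<in> level \<theta>) = cdf D \<theta>"
    using c level_null_unique[OF assms _ c] by (rule the_equality)
  moreover have "\<theta> \<in> {0..1}" using q quantile_unit[of q] by auto
  moreover have "quantile D (cdf D \<theta>) = \<theta>" using c by simp
  ultimately show ?thesis using assms by (simp only: uniform_draw_def if_True simp_thms)
qed

lemma sets_uniform_draw [simp, measurable_cong]: "sets (uniform_draw S) = sets borel"
  by (simp add: uniform_draw_def)

lemma prob_space_uniform_draw_level: "prob_space (uniform_draw (level \<theta>))"
proof (cases "emeasure lborel (level \<theta>) = 0")
  case True
  then show ?thesis by (auto simp: uniform_draw_def intro!: prob_space_return)
next
  case False
  moreover have "emeasure lborel (level \<theta>) \<noteq> \<infinity>"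
    using emeasure_level_le[of \<theta>] by (metis ennreal_one_less_top infinity_ennreal_def not_le)
  ultimately show ?thesis
    unfolding uniform_draw_def by (simp add: prob_space_uniform_measure)
qed

text \<open>
  A level set that is not a null set contains a rational, so the draw differs from a deterministic
  one for at most countably many abilities.
\<close>
lemma measurable_uniform_draw [measurable]:
  "(\<lambda>\<theta>. uniform_draw (level \<theta>)) \<in> measurable borel (subprob_algebra borel)"
proof (rule measurable_discrete_difference)
  let ?N = "quantile D ` (\<rat> \<inter> {0..1})"
  let ?g = "\<lambda>\<theta>. if \<theta> \<in> {0..1} \<and> quantile D (cdf D \<theta>) = \<theta> then cdf D \<theta> else (THE q. False)"
  have [measurable]: "cdf D \<in> borel_measurable borel"
    by (intro borel_measurable_mono monoI cdf_nondecreasing)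
  have "?g \<in> borel_measurable borel" by measurable
  then show "(\<lambda>\<theta>. return borel (?g \<theta>)) \<in> measurable borel (subprob_algebra borel)"
    by measurable
  show "countable ?N" by (intro countable_image countable_subset[OF _ countable_rat]) auto
  show "uniform_draw (level \<theta>) \<in> space (subprob_algebra borel)" for \<theta>
    by (simp add: space_subprob_algebra prob_space_imp_subprob_space prob_space_uniform_draw_level)
  show "return borel (?g \<theta>) = uniform_draw (level \<theta>)" if "\<theta> \<notin> ?N" for \<theta>
  proof -
    have le: "q' \<le> q" if q: "q \<in> level \<theta>" "q' \<in> level \<theta>" for q q'
    proof (rule ccontr)
      assume "\<not> q' \<le> q"
      then obtain r where r: "r \<in> \<rat>" "q < r" "r < q'"
        using Rats_dense_in_real[of q q'] by auto
      then have "r \<in> level \<theta>"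
        using level_between[OF q] by (intro subsetD[OF level_between[OF q]]) auto
      with r(1) \<open>\<theta> \<notin> ?N\<close> show False by auto
    qed
    have "\<exists>q. level \<theta> \<subseteq> {q}"
    proof (cases "level \<theta> = {}")
      case False
      then obtain q where "q \<in> level \<theta>" by blast
      with le show ?thesis by (intro exI[of _ q] subsetI) (metis antisym singletonI)
    qed simp
    then obtain q where "level \<theta> \<subseteq> {q}" by blast
    then have "emeasure lborel (level \<theta>) \<le> emeasure lborel {q}"
      by (intro emeasure_mono) auto
    then have "emeasure lborel (level \<theta>) = 0" by simp
    then show ?thesis by (rule uniform_draw_level_null[symmetric])
  qed
qed auto

lemma uniform_draw_level_disjoint:
  assumes "q \<in> level \<theta>" "A \<in> sets borel" "A \<inter> level \<theta> = {}"
  shows "emeasure (uniform_draw (level \<theta>)) A = 0"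
proof (cases "emeasure lborel (level \<theta>) = 0")
  case True
  have "(THE q. q \<in> level \<theta>) = q"
    using assms(1) level_null_unique[OF True _ assms(1)] by (rule the_equality)
  then have "uniform_draw (level \<theta>) = return borel q" using True by (simp only: uniform_draw_def if_True simp_thms)
  moreover have "q \<notin> A" using assms by blast
  ultimately show ?thesis using assms(2) by simp
next
  case False
  have "level \<theta> \<inter> A = {}" using assms(3) by blast
  with False assms(2) show ?thesis by (simp add: uniform_draw_def)
qed

lemma period_law_eq_bind:
  "period_law D = bind D (\<lambda>\<theta>. distr (uniform_draw (level \<theta>)) (borel \<Otimes>\<^sub>M borel) (Pair \<theta>))"
  unfolding period_law_def level_def[symmetric]
proof (intro bind_cong refl)
  fix \<theta> assume "\<theta> \<in> space D"
  interpret K: prob_space "uniform_draw (level \<theta>)" by (rule prob_space_uniform_draw_level)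
  show "bind (uniform_draw (level \<theta>)) (\<lambda>x. return (borel \<Otimes>\<^sub>M borel) (\<theta>, x)) =
      distr (uniform_draw (level \<theta>)) (borel \<Otimes>\<^sub>M borel) (Pair \<theta>)"
    by (rule bind_return_distr') (auto simp: K.not_empty)
qed

lemma measurable_period_kernel [measurable]:
  "(\<lambda>\<theta>. distr (uniform_draw (level \<theta>)) (borel \<Otimes>\<^sub>M borel) (Pair \<theta>))
     \<in> measurable D (subprob_algebra (borel \<Otimes>\<^sub>M borel))"
proof (rule measurable_distr2[where M = borel])
  show "(\<lambda>(\<theta>, x). (\<theta>, x)) \<in> measurable (D \<Otimes>\<^sub>M borel) (borel \<Otimes>\<^sub>M borel :: (real \<times> real) measure)"
    by (simp add: measurable_cong_sets[OF sets_pair_measure_cong[OF events_eq_borel refl] refl])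
  show "(\<lambda>\<theta>. uniform_draw (level \<theta>)) \<in> measurable D (subprob_algebra borel)"
    using measurable_uniform_draw by (simp add: measurable_cong_sets[OF events_eq_borel refl])
qed

lemma emeasure_period_law:
  assumes [measurable]: "A \<in> sets (borel \<Otimes>\<^sub>M borel)"
  shows "emeasure (period_law D) A = (\<integral>\<^sup>+ u. emeasure (uniform_draw (level (quantile D u))) (Pair (quantile D u) -` A) \<partial>unif)"
proof -
  have "emeasure (period_law D) A =
      (\<integral>\<^sup>+ \<theta>. emeasure (distr (uniform_draw (level \<theta>)) (borel \<Otimes>\<^sub>M borel) (Pair \<theta>)) A \<partial>D)"
    unfolding period_law_eq_bind
    by (rule emeasure_bind[OF not_empty measurable_period_kernel assms])
  also have "\<dots> = (\<integral>\<^sup>+ \<theta>. emeasure (distr (uniform_draw (level \<theta>)) (borel \<Otimes>\<^sub>M borel) (Pair \<theta>)) A \<partial>distr unif borel (quantile D))"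
    by (simp only: distr_quantile)
  also have "\<dots> = (\<integral>\<^sup>+ u. emeasure (distr (uniform_draw (level (quantile D u))) (borel \<Otimes>\<^sub>M borel) (Pair (quantile D u))) A \<partial>unif)"
    using measurable_emeasure_kernel[OF measurable_period_kernel assms]
    by (intro nn_integral_distr) auto
  also have "\<dots> = (\<integral>\<^sup>+ u. emeasure (uniform_draw (level (quantile D u))) (Pair (quantile D u) -` A) \<partial>unif)"
    by (intro nn_integral_cong, subst emeasure_distr) auto
  finally show ?thesis .
qed

lemma uniform_draw_level_full:
  assumes "q \<in> level \<theta>" "A \<in> sets borel" "level \<theta> \<subseteq> A"
  shows "emeasure (uniform_draw (level \<theta>)) A = 1"
proof -
  interpret K: prob_space "uniform_draw (level \<theta>)" by (rule prob_space_uniform_draw_level)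
  have sp: "space (uniform_draw (level \<theta>)) = UNIV"
    using sets_eq_imp_space_eq[OF sets_uniform_draw] by simp
  have "emeasure (uniform_draw (level \<theta>)) (- A) = 0"
    using assms by (intro uniform_draw_level_disjoint[of q]) auto
  moreover have "- A = space (uniform_draw (level \<theta>)) - A" by (auto simp: sp)
  ultimately have "1 - emeasure (uniform_draw (level \<theta>)) A = 0"
    using emeasure_compl[of A "uniform_draw (level \<theta>)"] assms(2) K.emeasure_space_1 by simp
  then have "1 \<le> emeasure (uniform_draw (level \<theta>)) A"
    by (simp add: ennreal_minus_eq_0)
  with K.emeasure_le_1[of A] show ?thesis by (intro antisym)
qed

text \<open>
  Multiplying out the normalization makes the identity hold for null level sets as well, so that no
  atom has to be singled out when the draw is averaged over a level set.
\<close>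
lemma emeasure_uniform_draw_level:
  assumes "A \<in> sets borel"
  shows "emeasure (uniform_draw (level \<theta>)) A * emeasure lborel (level \<theta>) = emeasure lborel (level \<theta> \<inter> A)"
proof (cases "emeasure lborel (level \<theta>) = 0")
  case True
  have "emeasure lborel (level \<theta> \<inter> A) \<le> emeasure lborel (level \<theta>)"
    using assms by (intro emeasure_mono) auto
  with True show ?thesis by simp
next
  case False
  have "emeasure lborel (level \<theta>) < top"
    using emeasure_level_le[of \<theta>] by (rule le_less_trans) simp
  with False assms show ?thesis
    by (simp add: uniform_draw_def ennreal_divide_times)
qed

lemma sets_period_law [simp, measurable_cong]: "sets (period_law D) = sets (borel \<Otimes>\<^sub>M borel)"
  unfolding period_law_eq_bind by (rule sets_bind) (auto simp: not_empty)

lemma space_period_law [simp]: "space (period_law D) = UNIV"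
  using sets_eq_imp_space_eq[OF sets_period_law] by (simp add: space_pair_measure)

lemma prob_space_period_law: "prob_space (period_law D)"
proof
  interpret U: prob_space unif by (rule prob_space_unif)
  have "UNIV \<in> sets (borel \<Otimes>\<^sub>M borel :: (real \<times> real) measure)"
    using sets.top[of "period_law D"] by simp
  then have "emeasure (period_law D) UNIV = (\<integral>\<^sup>+ u. emeasure (uniform_draw (level (quantile D u))) UNIV \<partial>unif)"
    by (subst emeasure_period_law) auto
  also have "\<dots> = (\<integral>\<^sup>+ u. 1 \<partial>unif)"
    using AE_unif
  proof (intro nn_integral_cong_AE, elim eventually_mono)
    fix u :: real assume "u \<in> {0<..<1}"
    then show "emeasure (uniform_draw (level (quantile D u))) UNIV = 1"
      by (intro uniform_draw_level_full[of u]) auto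
  qed
  also have "\<dots> = 1" using U.emeasure_space_1 by simp
  finally show "emeasure (period_law D) (space (period_law D)) = 1" by simp
qed

lemma AE_period_law: "AE z in period_law D. fst z = quantile D (snd z)"
proof (rule AE_I)
  let ?A = "{z. fst z \<noteq> quantile D (snd z)}"
  have [measurable]: "?A \<in> sets (borel \<Otimes>\<^sub>M borel)"
  proof -
    have "{z \<in> space (borel \<Otimes>\<^sub>M borel). fst z \<noteq> quantile D (snd z)} \<in> sets (borel \<Otimes>\<^sub>M borel :: (real \<times> real) measure)"
      by measurable
    then show ?thesis by (simp add: space_pair_measure)
  qed
  then show "?A \<in> sets (period_law D)" by simp
  have "emeasure (period_law D) ?A = (\<integral>\<^sup>+ u. 0 \<partial>unif)"
    unfolding emeasure_period_law[OF \<open>?A \<in> sets (borel \<Otimes>\<^sub>M borel)\<close>]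
    using AE_unif
  proof (intro nn_integral_cong_AE, elim eventually_mono)
    fix u :: real assume "u \<in> {0<..<1}"
    then show "emeasure (uniform_draw (level (quantile D u))) (Pair (quantile D u) -` ?A) = 0"
      by (intro uniform_draw_level_disjoint[of u]) auto
  qed
  then show "emeasure (period_law D) ?A = 0" by simp
qed auto

text \<open>
  Randomizing over the level set undoes the loss of information in passing from a uniform variable
  \<open>u\<close> to \<open>Q u\<close>. For the distribution function at \<open>a\<close> only the level set \<open>L\<close> of \<open>Q a\<close> matters: if
  \<open>Q u < Q a\<close> the draw is surely below \<open>a\<close>, if \<open>Q u > Q a\<close> surely above, and \<open>u \<in> L\<close> contributes the
  length of \<open>L\<close> times the fraction of \<open>L\<close> below \<open>a\<close>.
\<close>
lemma distr_period_law_snd: "distr (period_law D) borel snd = unif"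
proof (rule cdf_unique)
  interpret U: prob_space unif by (rule prob_space_unif)
  interpret P: prob_space "period_law D" by (rule prob_space_period_law)
  show "real_distribution (distr (period_law D) borel snd)"
    by (intro P.real_distribution_distr) measurable
  show "real_distribution unif"
    by standard auto
  show "cdf (distr (period_law D) borel snd) = cdf unif"
  proof
    fix a :: real
    let ?k = "\<lambda>u. emeasure (uniform_draw (level (quantile D u))) {..a}"
    have snd: "snd -` {..a} \<in> sets (borel \<Otimes>\<^sub>M borel :: (real \<times> real) measure)"
      using measurable_sets[OF measurable_snd, of "{..a}" borel borel] by (simp add: space_pair_measure)
    have "emeasure (distr (period_law D) borel snd) {..a} = emeasure (period_law D) (snd -` {..a})"
      by (simp add: emeasure_distr)
    also have "\<dots> = (\<integral>\<^sup>+ u. ?k u \<partial>unif)"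
      by (subst emeasure_period_law[OF snd]) (simp add: vimage_def atMost_def)
    also have "\<dots> = emeasure unif {..a}"
    proof -
      consider "a < 0" | "1 \<le> a" | "a \<in> {0..<1}" by fastforce
      then show ?thesis
      proof cases
        case 1
        have "(\<integral>\<^sup>+ u. ?k u \<partial>unif) = (\<integral>\<^sup>+ u. 0 \<partial>unif)"
          using AE_unif
        proof (intro nn_integral_cong_AE, elim eventually_mono)
          fix u :: real assume "u \<in> {0<..<1}"
          then show "?k u = 0" using 1 by (intro uniform_draw_level_disjoint[of u]) auto
        qed
        moreover have "{0<..<1} \<inter> {..a} = {}" using 1 by auto
        ultimately show ?thesis by (simp add: emeasure_unif)
      next
        case 2
        have "(\<integral>\<^sup>+ u. ?k u \<partial>unif) = (\<integral>\<^sup>+ u. 1 \<partial>unif)"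
          using AE_unif
        proof (intro nn_integral_cong_AE, elim eventually_mono)
          fix u :: real assume "u \<in> {0<..<1}"
          then show "?k u = 1" using 2 by (intro uniform_draw_level_full[of u]) auto
        qed
        moreover have "{0<..<1} \<inter> {..a} = {0<..<1}" using 2 by auto
        ultimately show ?thesis using U.emeasure_space_1 by (simp add: emeasure_unif)
      next
        case 3
        let ?\<theta> = "quantile D a" and ?L = "level (quantile D a)"
        let ?c = "emeasure (uniform_draw ?L) {..a}"
        let ?below = "{u. quantile D u < ?\<theta>}" and ?at = "{u. quantile D u = ?\<theta>}"
        have [measurable]: "?below \<in> sets borel" "?at \<in> sets borel"
          by measurable
        have lt: "q < a" if "quantile D q < ?\<theta>" "q \<le> 1" for q
          using quantile_mono[of a q] that by (cases "q < a") auto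
        have gt: "a < q" if "quantile D q > ?\<theta>" "q \<ge> 0" for q
          using quantile_mono[of q a] that 3 by (cases "a < q") auto
        have "(\<integral>\<^sup>+ u. ?k u \<partial>unif) = (\<integral>\<^sup>+ u. indicator ?below u + ?c * indicator ?at u \<partial>unif)"
          using AE_unif
        proof (intro nn_integral_cong_AE, elim eventually_mono)
          fix u :: real assume u: "u \<in> {0<..<1}"
          consider "quantile D u < ?\<theta>" | "quantile D u = ?\<theta>" | "quantile D u > ?\<theta>" by linarith
          then show "?k u = indicator ?below u + ?c * indicator ?at u"
          proof cases
            case 1
            then have "?k u = 1" using u lt by (intro uniform_draw_level_full[of u]) (auto simp: less_imp_le)
            with 1 show ?thesis by simp
          next
            case 3
            have "\<not> q \<le> a" if "q \<in> level (quantile D u)" for q using gt[of q] 3 that by auto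
            then have "?k u = 0" using u by (intro uniform_draw_level_disjoint[of u]) auto
            with 3 show ?thesis by simp
          qed simp
        qed
        also have "\<dots> = emeasure unif ?below + ?c * emeasure unif ?at"
          by (subst nn_integral_add) (auto simp: nn_integral_cmult)
        also have "emeasure unif ?at = emeasure lborel ?L"
        proof -
          have "emeasure lborel ({0<..<1} \<inter> ?at) = emeasure lborel ?L"
          proof (rule emeasure_eq_AE)
            show "AE x in lborel. (x \<in> {0<..<1} \<inter> ?at) = (x \<in> ?L)"
              using AE_lborel_singleton[of 0] AE_lborel_singleton[of 1]
              by eventually_elim (auto simp: order_less_le)
          qed auto
          then show ?thesis by (simp add: emeasure_unif)
        qed
        also have "?c * emeasure lborel ?L = emeasure lborel (?L \<inter> {..a})"
          by (rule emeasure_uniform_draw_level) simp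
        also have "emeasure lborel (?L \<inter> {..a}) = emeasure unif (?at \<inter> {..a})"
        proof -
          have "emeasure lborel (?L \<inter> {..a}) = emeasure lborel ({0<..<1} \<inter> (?at \<inter> {..a}))"
          proof (rule emeasure_eq_AE)
            show "AE x in lborel. (x \<in> ?L \<inter> {..a}) = (x \<in> {0<..<1} \<inter> (?at \<inter> {..a}))"
              using AE_lborel_singleton[of 0] AE_lborel_singleton[of 1]
              by eventually_elim (auto simp: order_less_le)
          qed auto
          then show ?thesis by (simp add: emeasure_unif)
        qed
        also have "emeasure unif ?below + \<dots> = emeasure unif (?below \<union> (?at \<inter> {..a}))"
          by (rule plus_emeasure) auto
        also have "\<dots> = emeasure unif {..a}"
        proof (rule emeasure_eq_AE)
          show "AE x in unif. (x \<in> ?below \<union> (?at \<inter> {..a})) = (x \<in> {..a})"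
            using AE_unif
          proof (elim eventually_mono)
            fix u :: real assume u: "u \<in> {0<..<1}"
            show "(u \<in> ?below \<union> (?at \<inter> {..a})) = (u \<in> {..a})"
              using lt[of u] gt[of u] u by (cases "quantile D u" ?\<theta> rule: linorder_cases) auto
          qed
        qed auto
        finally show ?thesis .
      qed
    qed
    finally show "cdf (distr (period_law D) borel snd) a = cdf unif a"
      by (simp add: cdf_def measure_def)
  qed
qed

text \<open>
  The ability is almost surely the quantile function at the drawn quantile, so the marginal law of
  the latter determines the joint law.
\<close>
lemma period_law_eq_distr:
  "period_law D = distr unif (borel \<Otimes>\<^sub>M borel) (\<lambda>u. (quantile D u, u))"
proof -
  have "distr unif (borel \<Otimes>\<^sub>M borel) (\<lambda>u. (quantile D u, u)) =
      distr (period_law D) (borel \<Otimes>\<^sub>M borel) (\<lambda>z. (quantile D (snd z), snd z))"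
    unfolding distr_period_law_snd[symmetric] by (subst distr_distr) (auto simp: o_def)
  also have "\<dots> = distr (period_law D) (borel \<Otimes>\<^sub>M borel) (\<lambda>z. z)"
    using AE_period_law by (intro distr_cong_AE) (auto elim!: eventually_mono intro: prod_eqI)
  also have "\<dots> = period_law D"
    by (rule distr_id2) simp
  finally show ?thesis by simp
qed

end

section \<open>Backward recursions for the hindsight optimum and the policy\<close>

text \<open>
  In the following recursions \<open>n\<close> counts the remaining periods \<open>T - n + 1, \<dots>, T\<close>, so that the step
  from \<open>n\<close> to \<open>Suc n\<close> prepends period \<open>T - n\<close>; the last argument \<open>b\<close> is the remaining budget.
\<close>
primrec best_value :: "nat \<Rightarrow> (nat \<Rightarrow> real) \<Rightarrow> nat \<Rightarrow> nat \<Rightarrow> real" where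
  "best_value T \<theta> 0 b = 0"
| "best_value T \<theta> (Suc n) b =
     (if b = 0 then 0 else max (\<theta> (T - n) + best_value T \<theta> n (b - 1)) (best_value T \<theta> n b))"

primrec cwg_value :: "nat \<Rightarrow> (nat \<Rightarrow> real) \<Rightarrow> (nat \<Rightarrow> real) \<Rightarrow> nat \<Rightarrow> nat \<Rightarrow> real" where
  "cwg_value T \<theta> x 0 b = 0"
| "cwg_value T \<theta> x (Suc n) b =
     (if cwg_accepts T (T - n) b (x (T - n)) then \<theta> (T - n) + cwg_value T \<theta> x n (b - 1)
      else cwg_value T \<theta> x n b)"

text \<open>
  For \<open>x\<close> with values in the unit interval, the \<open>b\<close>-th largest of the remaining \<open>x t\<close>, with the convention that it is \<open>1\<close> for \<open>b = 0\<close> and \<open>0\<close>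
  if fewer than \<open>b\<close> periods remain. The recursion inserts a new element into a decreasing sequence:
  position \<open>b\<close> keeps its entry, receives the new element, or receives the entry of position \<open>b - 1\<close>.
\<close>
primrec cutoff :: "nat \<Rightarrow> (nat \<Rightarrow> real) \<Rightarrow> nat \<Rightarrow> nat \<Rightarrow> real" where
  "cutoff T x 0 b = (if b = 0 then 1 else 0)"
| "cutoff T x (Suc n) b =
     (if b = 0 then 1 else max (cutoff T x n b) (min (x (T - n)) (cutoff T x n (b - 1))))"

lemma future_insert: "n < T \<Longrightarrow> {T - Suc n<..T} = insert (T - n) {T - n<..T}" for n T :: nat
  by auto

lemma best_value_0 [simp]: "best_value T \<theta> n 0 = 0"
  by (cases n) auto

lemma cutoff_0 [simp]: "cutoff T x n 0 = 1"
  by (cases n) auto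

lemma best_value_cong:
  "n \<le> T \<Longrightarrow> (\<And>t. t \<in> {T - n<..T} \<Longrightarrow> \<theta> t = \<theta>' t) \<Longrightarrow> best_value T \<theta> n b = best_value T \<theta>' n b"
  by (induction n arbitrary: b) (auto simp: future_insert)

lemma cwg_value_cong:
  "n \<le> T \<Longrightarrow> (\<And>t. t \<in> {T - n<..T} \<Longrightarrow> \<theta> t = \<theta>' t \<and> x t = x' t) \<Longrightarrow>
   cwg_value T \<theta> x n b = cwg_value T \<theta>' x' n b"
  by (induction n arbitrary: b) (auto simp: future_insert)

lemma cutoff_cong:
  "n \<le> T \<Longrightarrow> (\<And>t. t \<in> {T - n<..T} \<Longrightarrow> x t = x' t) \<Longrightarrow> cutoff T x n b = cutoff T x' n b"
  by (induction n arbitrary: b) (auto simp: future_insert)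

lemma best_value_nonneg:
  "n \<le> T \<Longrightarrow> (\<And>t. t \<in> {T - n<..T} \<Longrightarrow> 0 \<le> \<theta> t) \<Longrightarrow> 0 \<le> best_value T \<theta> n b"
  by (induction n arbitrary: b) (auto simp: future_insert le_max_iff_disj)

lemma best_value_le:
  "n \<le> T \<Longrightarrow> (\<And>t. t \<in> {T - n<..T} \<Longrightarrow> \<theta> t \<le> 1) \<Longrightarrow> best_value T \<theta> n b \<le> real n"
proof (induction n arbitrary: b)
  case (Suc n)
  have "best_value T \<theta> n b' \<le> real n" for b'
    using Suc by (auto simp: future_insert)
  from this[of b] this[of "b - 1"] show ?case
    using Suc.prems by (auto simp: future_insert intro: add_mono)
qed auto

lemma cwg_value_le_best_value:
  "n \<le> T \<Longrightarrow> (\<And>t. t \<in> {T - n<..T} \<Longrightarrow> 0 \<le> \<theta> t) \<Longrightarrow>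
   cwg_value T \<theta> x n b \<le> best_value T \<theta> n b"
proof (induction n arbitrary: b)
  case (Suc n)
  have "cwg_value T \<theta> x n b' \<le> best_value T \<theta> n b'" for b'
    using Suc by (auto simp: future_insert)
  from this[of b] this[of "b - 1"] this[of 0] show ?case
    by (auto simp: le_max_iff_disj cwg_accepts_def)
qed auto

lemma cwg_value_nonneg:
  "n \<le> T \<Longrightarrow> (\<And>t. t \<in> {T - n<..T} \<Longrightarrow> 0 \<le> \<theta> t) \<Longrightarrow> 0 \<le> cwg_value T \<theta> x n b"
  by (induction n arbitrary: b) (auto simp: future_insert)

text \<open>
  Dynamic programming dominates every selection within the budget. The hindsight reward enters the
  regret with a positive sign, so an upper bound for it is what the regret bound asks for.
\<close>
lemma sum_le_best_value:
  fixes a :: "nat \<Rightarrow> nat"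
  assumes "n \<le> T" "\<And>t. t \<in> {T - n<..T} \<Longrightarrow> a t \<le> 1" "(\<Sum>t\<in>{T - n<..T}. a t) \<le> b"
  shows "(\<Sum>t\<in>{T - n<..T}. \<theta> t * real (a t)) \<le> best_value T \<theta> n b"
  using assms
proof (induction n arbitrary: b)
  case (Suc n)
  have le: "n \<le> T" "n < T" and I: "{T - Suc n<..T} = insert (T - n) {T - n<..T}"
    using Suc.prems by (auto simp: future_insert)
  have IH: "(\<Sum>t\<in>{T - n<..T}. a t) \<le> b' \<Longrightarrow>
      (\<Sum>t\<in>{T - n<..T}. \<theta> t * real (a t)) \<le> best_value T \<theta> n b'" for b'
    using Suc.prems le by (intro Suc.IH) (auto simp: I)
  have sum: "a (T - n) + (\<Sum>t\<in>{T - n<..T}. a t) \<le> b"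
    using Suc.prems(3) by (simp add: I)
  have "a (T - n) \<le> 1" using Suc.prems(2) by (auto simp: I)
  then consider "a (T - n) = 0" | "a (T - n) = 1" by linarith
  then show ?case
  proof cases
    case 1
    with IH[of b] sum show ?thesis by (auto simp: I le_max_iff_disj)
  next
    case 2
    with IH[of "b - 1"] sum show ?thesis by (auto simp: I le_max_iff_disj)
  qed
qed auto

lemma offline_reward_le_best_value: "offline_reward T B \<theta> \<le> best_value T \<theta> T B"
proof -
  have I: "{1..T} = {T - T<..T}" by auto
  let ?A = "{a \<in> {1..T} \<rightarrow>\<^sub>E {0, 1::nat}. (\<Sum>t=1..T. a t) \<le> B}"
  have "finite ?A" by (intro finite_subset[OF _ finite_PiE[of "{1..T}" "\<lambda>_. {0, 1::nat}"]]) auto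
  moreover have "restrict (\<lambda>_. 0) {1..T} \<in> ?A" by auto
  then have "?A \<noteq> {}" by blast
  moreover have "(\<Sum>t=1..T. \<theta> t * real (a t)) \<le> best_value T \<theta> T B" if "a \<in> ?A" for a
  proof -
    have "(\<Sum>t\<in>{T - T<..T}. \<theta> t * real (a t)) \<le> best_value T \<theta> T B"
    proof (rule sum_le_best_value)
      fix t assume "t \<in> {T - T<..T}"
      with that have "a t \<in> {0, 1}" by (auto simp: I PiE_iff)
      then show "a t \<le> 1" by auto
    next
      show "(\<Sum>t\<in>{T - T<..T}. a t) \<le> B" using that by (simp only: I mem_Collect_eq)
    qed simp
    then show ?thesis by (simp only: I)
  qed
  ultimately show ?thesis
    unfolding offline_reward_def by (subst Max_le_iff) auto
qed

text \<open>
  The budget is defined forward in time and the value backward; the identity joins them at the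
  period where the backward recursion starts.
\<close>
lemma cwg_reward_eq_cwg_value:
  assumes "n \<le> T"
  shows "(\<Sum>t\<in>{T - n<..T}. \<theta> t * of_bool (cwg_accepts T t (cwg_budget T B x t) (x t)))
    = cwg_value T \<theta> x n (cwg_budget T B x (Suc (T - n)))"
  using assms
proof (induction n)
  case (Suc n)
  have "Suc (T - Suc n) = T - n" using Suc.prems by simp
  with Suc show ?case by (auto simp: future_insert)
qed auto

section \<open>The marginal value of budget is an order statistic\<close>

lemma cutoff_bounds:
  assumes "n \<le> T" "\<And>t. t \<in> {T - n<..T} \<Longrightarrow> x t \<in> {0..1}"
  shows "cutoff T x n b \<in> {0..1}"
  using assms by (induction n arbitrary: b) (auto simp: future_insert le_max_iff_disj min_le_iff_disj)

lemma cutoff_decreasing: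
  assumes "n \<le> T" "\<And>t. t \<in> {T - n<..T} \<Longrightarrow> x t \<in> {0..1}"
  shows "cutoff T x n (Suc b) \<le> cutoff T x n b"
  using assms
proof (induction n arbitrary: b)
  case (Suc n)
  have IH: "cutoff T x n (Suc b') \<le> cutoff T x n b'" for b'
    using Suc by (auto simp: future_insert)
  have "cutoff T x n b' \<in> {0..1}" for b'
    using Suc.prems by (intro cutoff_bounds) (auto simp: future_insert)
  then show ?case using IH[of b] IH[of "b - 1"] Suc.prems
    by (cases b) (auto simp: future_insert min_def max_def)
qed auto

lemma cutoff_eq_0:
  assumes "n \<le> T" "\<And>t. t \<in> {T - n<..T} \<Longrightarrow> 0 \<le> x t" "n < b"
  shows "cutoff T x n b = 0"
  using assms by (induction n arbitrary: b) (auto simp: future_insert)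

lemma cutoff_pos:
  assumes "n \<le> T" "\<And>t. t \<in> {T - n<..T} \<Longrightarrow> 0 < x t" "b \<le> n"
  shows "0 < cutoff T x n b"
  using assms
proof (induction n arbitrary: b)
  case (Suc n)
  have IH: "0 < cutoff T x n b'" if "b' \<le> n" for b'
    using Suc that by (auto simp: future_insert)
  show ?case using IH[of b] IH[of "b - 1"] Suc.prems
    by (cases "b = Suc n") (auto simp: future_insert less_max_iff_disj)
qed auto

text \<open>
  Write \<open>V\<close> for the hindsight value, \<open>d b = V b - V (b - 1)\<close> and \<open>\<theta>\<close> for the prepended ability. The
  new value is \<open>V (b - 1) + max \<theta> (d b)\<close>, so the new increment is
  \<open>max \<theta> (d b) + d (b - 1) - max \<theta> (d (b - 1))\<close>. Since \<open>d\<close> is decreasing, this equals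
  \<open>max (d b) (min \<theta> (d (b - 1)))\<close>, the recursion of the cutoff. A monotone \<open>Q\<close> commutes with
  minimum and maximum.
\<close>
lemma marginal_value_eq_cutoff:
  assumes Q: "mono_on {0..1} Q" "Q 0 = 0"
    and "n \<le> T" "\<And>t. t \<in> {T - n<..T} \<Longrightarrow> x t \<in> {0..1}"
  shows "best_value T (\<lambda>t. Q (x t)) n (Suc b) = best_value T (\<lambda>t. Q (x t)) n b + Q (cutoff T x n (Suc b))"
  using assms(3,4)
proof (induction n arbitrary: b)
  case (Suc n)
  have IH: "best_value T (\<lambda>t. Q (x t)) n (Suc b') = best_value T (\<lambda>t. Q (x t)) n b' + Q (cutoff T x n (Suc b'))" for b'
    by (rule Suc.IH) (use Suc.prems in \<open>auto simp: future_insert\<close>)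
  have x: "x (T - n) \<in> {0..1}" and y: "cutoff T x n b' \<in> {0..1}" for b'
    using Suc.prems by (auto intro!: cutoff_bounds simp: future_insert simp del: atLeastAtMost_iff)
  have Q_le: "u \<in> {0..1} \<Longrightarrow> v \<in> {0..1} \<Longrightarrow> u \<le> v \<Longrightarrow> Q u \<le> Q v" for u v
    using Q(1) by (auto simp: mono_on_def)
  have Q_max: "Q (max u v) = max (Q u) (Q v)" and Q_min: "Q (min u v) = min (Q u) (Q v)"
    if "u \<in> {0..1}" "v \<in> {0..1}" for u v
    using Q_le[of u v] Q_le[of v u] that by (auto simp: max_def min_def)
  show ?case
  proof (cases b)
    case 0
    have "min (x (T - n)) 1 = x (T - n)" using x by auto
    with 0 IH[of 0] Q_max[OF x y[of 1]] show ?thesis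
      by (auto simp: max.commute)
  next
    case b: (Suc b')
    have dec: "cutoff T x n (Suc b) \<le> cutoff T x n b"
      using Suc.prems by (intro cutoff_decreasing) (auto simp: future_insert)
    have min01: "min (x (T - n)) (cutoff T x n b) \<in> {0..1}"
      using x y[of b] by auto
    have "Q (cutoff T x n (Suc b)) \<le> Q (cutoff T x n b)"
      by (rule Q_le[OF y y dec])
    then show ?thesis using IH[of b] IH[of b']
      by (simp add: b Q_max[OF y[of "Suc (Suc b')"] min01[unfolded b]] Q_min[OF x y[of "Suc b'"]])
  qed
qed (use Q in auto)

section \<open>Regret path by path\<close>

text \<open>
  What one decision costs a decision maker who acts with hindsight in all later periods. Here \<open>n\<close>
  counts the periods after the current one, \<open>T - n\<close>. Without budget the rejection is forced and costs
  nothing.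
\<close>
definition cwg_loss :: "nat \<Rightarrow> (real \<Rightarrow> real) \<Rightarrow> nat \<Rightarrow> nat \<Rightarrow> (nat \<Rightarrow> real) \<Rightarrow> real" where
  "cwg_loss T Q n b x =
     (if cwg_accepts T (T - n) b (x (T - n)) then max 0 (Q (cutoff T x n b) - Q (x (T - n)))
      else if b = 0 then 0 else max 0 (Q (x (T - n)) - Q (cutoff T x n b)))"

definition path_regret :: "nat \<Rightarrow> (real \<Rightarrow> real) \<Rightarrow> nat \<Rightarrow> nat \<Rightarrow> (nat \<Rightarrow> real) \<Rightarrow> real" where
  "path_regret T Q n b x = best_value T (\<lambda>t. Q (x t)) n b - cwg_value T (\<lambda>t. Q (x t)) x n b"

text \<open>
  Let \<open>V\<close> be the hindsight value of the later periods, \<open>y\<close> the cutoff and \<open>u\<close> the current quantile. By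
  \<open>marginal_value_eq_cutoff\<close> the hindsight value including the current period is
  \<open>V (b - 1) + max (Q u) (Q y)\<close>. Accepting and then acting with hindsight yields \<open>V (b - 1) + Q u\<close>,
  rejecting yields \<open>V b = V (b - 1) + Q y\<close>.
\<close>
lemma path_regret_Suc:
  assumes Q: "mono_on {0..1} Q" "Q 0 = 0"
    and "n < T" "\<And>t. t \<in> {T - n<..T} \<Longrightarrow> x t \<in> {0..1}"
  shows "path_regret T Q (Suc n) b x = cwg_loss T Q n b x +
    (if cwg_accepts T (T - n) b (x (T - n)) then path_regret T Q n (b - 1) x
     else path_regret T Q n b x)"
proof (cases b)
  case (Suc b')
  from marginal_value_eq_cutoff[OF Q, of n T x b'] assms Suc show ?thesis
    by (auto simp: path_regret_def cwg_loss_def)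
qed (auto simp: path_regret_def cwg_loss_def cwg_accepts_def)

lemma cwg_threshold_eq: "n < T \<Longrightarrow> cwg_threshold T (T - n) b = 1 - real b / (real n + 1)"
  by (simp add: cwg_threshold_def of_nat_diff)

text \<open>
  Decision and hindsight disagree only if the current quantile lies between threshold and cutoff, and
  then it is no further from the cutoff than the threshold is. As the Hoelder bound is available
  on \<open>(0, 1]\<close> only, the cutoff has to be positive; this is where \<open>b \<le> n\<close> and the open unit interval
  are needed.
\<close>
lemma cwg_loss_le:
  assumes Q: "mono_on {0..1} Q" "Q 0 = 0"
    and Hoelder: "\<And>q q'. q \<in> {0<..1} \<Longrightarrow> q' \<in> {0<..1} \<Longrightarrow> \<bar>Q q - Q q'\<bar> \<le> C * \<bar>q - q'\<bar> powr s"
    and "0 \<le> C" "0 \<le> s" "n < T" and x: "\<And>t. t \<in> {T - Suc n<..T} \<Longrightarrow> x t \<in> {0<..<1}"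
    and b: "b \<in> {1..n}"
  defines "p \<equiv> 1 - real b / (real n + 1)" and "y \<equiv> cutoff T x n b"
  shows "cwg_loss T Q n b x \<le> C * \<bar>y - p\<bar> powr s * indicator {min p y..max p y} (x (T - n))"
proof -
  have u: "x (T - n) \<in> {0<..<1}" using x \<open>n < T\<close> by (auto simp: future_insert)
  have "y \<in> {0..1}" unfolding y_def using x \<open>n < T\<close>
    by (intro cutoff_bounds) (auto simp: future_insert less_imp_le)
  moreover have "0 < y" unfolding y_def using x \<open>n < T\<close> b
    by (intro cutoff_pos) (auto simp: future_insert)
  ultimately have y: "y \<in> {0<..1}" by auto
  let ?u = "x (T - n)"
  have acc: "cwg_accepts T (T - n) b ?u \<longleftrightarrow> p \<le> ?u"
    using b \<open>n < T\<close> by (auto simp: cwg_accepts_def cwg_threshold_eq p_def)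
  have nn: "0 \<le> C * \<bar>y - p\<bar> powr s * indicator {min p y..max p y} ?u"
    using \<open>0 \<le> C\<close> by auto
  have less: "Q v \<le> Q w" if "v \<in> {0<..1}" "w \<in> {0<..1}" "v \<le> w" for v w
    using Q(1) that by (auto simp: mono_on_def)
  have diff: "\<bar>Q ?u - Q y\<bar> \<le> C * \<bar>y - p\<bar> powr s" if "?u \<in> {min p y..max p y}"
  proof -
    have "\<bar>Q ?u - Q y\<bar> \<le> C * \<bar>?u - y\<bar> powr s" using Hoelder u y by auto
    also have "\<bar>?u - y\<bar> \<le> \<bar>y - p\<bar>" using that by (auto simp: abs_if min_def max_def split: if_splits)
    then have "C * \<bar>?u - y\<bar> powr s \<le> C * \<bar>y - p\<bar> powr s"
      using \<open>0 \<le> C\<close> \<open>0 \<le> s\<close> by (intro mult_left_mono powr_mono2) auto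
    finally show ?thesis .
  qed
  show ?thesis
  proof (cases "?u \<in> {min p y..max p y}")
    case True
    with diff b show ?thesis
      by (auto simp: cwg_loss_def y_def[symmetric] abs_le_iff zero_le_mult_iff \<open>0 \<le> C\<close>)
  next
    case False
    have "cwg_loss T Q n b x = 0"
    proof (cases "p \<le> ?u")
      case True
      with False have "y \<le> ?u" by (auto simp: min_def max_def split: if_splits)
      with True less[of y ?u] u y show ?thesis by (auto simp: cwg_loss_def acc y_def[symmetric])
    next
      case c: False
      with False have "?u \<le> y" by (auto simp: min_def max_def split: if_splits)
      with c less[of ?u y] u y b show ?thesis by (auto simp: cwg_loss_def acc y_def[symmetric])
    qed
    with nn show ?thesis by simp
  qed
qed

text \<open>
  Without budget nothing is at stake. With budget for all \<open>Suc n\<close> remaining periods the threshold is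
  \<open>0\<close> and the policy accepts, as the hindsight optimum does.
\<close>
lemma cwg_loss_eq_0:
  assumes Q: "mono_on {0..1} Q" "Q 0 = 0"
    and "n < T" and x: "\<And>t. t \<in> {T - Suc n<..T} \<Longrightarrow> x t \<in> {0<..<1}"
    and b: "b \<in> {0, Suc n}"
  shows "cwg_loss T Q n b x = 0"
proof -
  have u: "x (T - n) \<in> {0<..<1}" using x \<open>n < T\<close> by (auto simp: future_insert)
  then have "Q 0 \<le> Q (x (T - n))" using Q(1) by (auto simp: mono_on_def)
  moreover have "cutoff T x n (Suc n) = 0"
    using x \<open>n < T\<close> by (intro cutoff_eq_0) (auto simp: future_insert less_imp_le)
  moreover have "cwg_threshold T (T - n) (Suc n) = 0"
    using \<open>n < T\<close> by (simp add: cwg_threshold_eq field_simps)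
  ultimately show ?thesis using b u Q(2)
    by (auto simp: cwg_loss_def cwg_accepts_def)
qed

section \<open>Moments of the cutoff quantile\<close>

lemma unif_eq_density: "unif = density lborel (\<lambda>u. ennreal (indicator {0<..<1} u))"
  unfolding unif_def uniform_measure_def by (intro density_cong) (auto simp: divide_ennreal_def ennreal_indicator)

lemma integral_unif_continuous:
  fixes f :: "real \<Rightarrow> real"
  assumes "continuous_on UNIV f" "(f has_integral I) {0..1}"
  shows "(\<integral>u. f u \<partial>unif) = I"
proof -
  have [measurable]: "f \<in> borel_measurable borel"
    using assms(1) by (rule borel_measurable_continuous_onI)
  have "(\<integral>u. f u \<partial>unif) = (\<integral>u. indicator {0<..<1} u *\<^sub>R f u \<partial>lborel)"
    unfolding unif_eq_density by (subst integral_density) auto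
  also have "\<dots> = (\<integral>u. indicator {0..1} u *\<^sub>R f u \<partial>lborel)"
  proof (rule integral_cong_AE)
    show "AE u in lborel. indicator {0<..<1} u *\<^sub>R f u = indicator {0..1} u *\<^sub>R f u"
      using AE_lborel_singleton[of 0] AE_lborel_singleton[of 1]
      by eventually_elim (auto simp: indicator_def)
  qed auto
  also have "\<dots> = integral {0..1} f"
  proof -
    have "set_integrable lborel {0..1} f"
      using assms(1) by (intro borel_integrable_atLeastAtMost') (auto intro: continuous_on_subset)
    from set_borel_integral_eq_integral(2)[OF this] show ?thesis
      by (simp add: set_lebesgue_integral_def)
  qed
  also have "\<dots> = I" using assms(2) by (rule integral_unique)
  finally show ?thesis .
qed

text \<open>
  The integrand is one step of the recursion for the cutoff, with the old cutoffs \<open>v \<le> w\<close> at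
  budget \<open>b\<close> and \<open>b - 1\<close>; it equals \<open>v\<close>, \<open>u\<close> and \<open>w\<close> on three consecutive intervals.
\<close>
lemma integral_unif_clamp_power:
  assumes "0 \<le> v" "v \<le> w" "w \<le> 1"
  shows "(\<integral>u. max v (min u w) ^ k \<partial>unif) = w ^ k - real k / (real k + 1) * (w ^ (k + 1) - v ^ (k + 1))"
proof (rule integral_unif_continuous)
  let ?f = "\<lambda>u. max v (min u w) ^ k"
  let ?F = "\<lambda>u::real. u ^ (k + 1) / (real k + 1)"
  show "continuous_on UNIV ?f" by (intro continuous_intros)
  have "((\<lambda>u. v ^ k) has_integral v * v ^ k) {0..v}"
    using has_integral_const_real[of "v ^ k" 0 v] assms by simp
  then have 1: "(?f has_integral v * v ^ k) {0..v}"
    using assms by (subst has_integral_cong[where g = "\<lambda>u. v ^ k"]) auto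
  have "((\<lambda>u. u ^ k) has_integral (?F w - ?F v)) {v..w}"
  proof (rule fundamental_theorem_of_calculus)
    fix u
    have "(?F has_real_derivative real (k + 1) * u ^ (k + 1 - Suc 0) / (real k + 1)) (at u within {v..w})"
      by (intro DERIV_cdivide DERIV_pow)
    moreover have "real (k + 1) * u ^ (k + 1 - Suc 0) / (real k + 1) = u ^ k" by (simp add: divide_simps)
    ultimately have "(?F has_real_derivative u ^ k) (at u within {v..w})" by (simp only:)
    then show "(?F has_vector_derivative u ^ k) (at u within {v..w})"
      by (simp add: has_real_derivative_iff_has_vector_derivative)
  qed (use assms in auto)
  then have 2: "(?f has_integral (?F w - ?F v)) {v..w}"
    using assms by (subst has_integral_cong[where g = "\<lambda>u. u ^ k"]) auto
  have "((\<lambda>u. w ^ k) has_integral (1 - w) * w ^ k) {w..1}"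
    using has_integral_const_real[of "w ^ k" w 1] assms by simp
  then have 3: "(?f has_integral (1 - w) * w ^ k) {w..1}"
    using assms by (subst has_integral_cong[where g = "\<lambda>u. w ^ k"]) auto
  have "(?f has_integral (v * v ^ k + (?F w - ?F v)) + (1 - w) * w ^ k) {0..1}"
    using assms by (intro has_integral_combine[OF _ _ has_integral_combine[OF _ _ 1 2] 3]) auto
  also have "(v * v ^ k + (?F w - ?F v)) + (1 - w) * w ^ k =
      w ^ k - real k / (real k + 1) * (w ^ (k + 1) - v ^ (k + 1))"
  proof -
    have "v * V + (w * W / K - v * V / K) + (1 - w) * W = W - (K - 1) / K * (w * W - v * V)"
      if "K \<noteq> 0" for V W K :: real
      using that by (simp add: divide_simps) (simp add: algebra_simps)
    from this[of "real k + 1" "v ^ k" "w ^ k"] show ?thesis by simp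
  qed
  finally show "(?f has_integral w ^ k - real k / (real k + 1) * (w ^ (k + 1) - v ^ (k + 1))) {0..1}" .
qed

lemma measurable_best_value:
  assumes "n \<le> T" "\<And>t. t \<in> {T - n<..T} \<Longrightarrow> \<theta> t \<in> borel_measurable M"
  shows "(\<lambda>\<omega>. best_value T (\<lambda>t. \<theta> t \<omega>) n b) \<in> borel_measurable M"
  using assms
proof (induction n arbitrary: b)
  case (Suc n)
  have [measurable]: "(\<lambda>\<omega>. best_value T (\<lambda>t. \<theta> t \<omega>) n b') \<in> borel_measurable M" for b'
    using Suc by (auto simp: future_insert)
  have [measurable]: "\<theta> (T - n) \<in> borel_measurable M"
    using Suc.prems by (auto simp: future_insert)
  show ?case by simp
qed simp

lemma measurable_cwg_value:
  assumes "n \<le> T" "\<And>t. t \<in> {T - n<..T} \<Longrightarrow> \<theta> t \<in> borel_measurable M"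
    "\<And>t. t \<in> {T - n<..T} \<Longrightarrow> x t \<in> borel_measurable M"
  shows "(\<lambda>\<omega>. cwg_value T (\<lambda>t. \<theta> t \<omega>) (\<lambda>t. x t \<omega>) n b) \<in> borel_measurable M"
  using assms
proof (induction n arbitrary: b)
  case (Suc n)
  have [measurable]: "(\<lambda>\<omega>. cwg_value T (\<lambda>t. \<theta> t \<omega>) (\<lambda>t. x t \<omega>) n b') \<in> borel_measurable M" for b'
    using Suc by (auto simp: future_insert)
  have [measurable]: "\<theta> (T - n) \<in> borel_measurable M" "x (T - n) \<in> borel_measurable M"
    using Suc.prems by (auto simp: future_insert)
  show ?case by (simp add: cwg_accepts_def)
qed simp

lemma measurable_cutoff:
  assumes "n \<le> T" "\<And>t. t \<in> {T - n<..T} \<Longrightarrow> x t \<in> borel_measurable M"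
  shows "(\<lambda>\<omega>. cutoff T (\<lambda>t. x t \<omega>) n b) \<in> borel_measurable M"
  using assms
proof (induction n arbitrary: b)
  case (Suc n)
  have [measurable]: "(\<lambda>\<omega>. cutoff T (\<lambda>t. x t \<omega>) n b') \<in> borel_measurable M" for b'
    using Suc by (auto simp: future_insert)
  have [measurable]: "x (T - n) \<in> borel_measurable M"
    using Suc.prems by (auto simp: future_insert)
  show ?case by simp
qed simp

abbreviation future_law :: "nat \<Rightarrow> nat \<Rightarrow> (nat \<Rightarrow> real) measure" where
  "future_law T n \<equiv> \<Pi>\<^sub>M t\<in>{T - n<..T}. unif"

lemma measurable_unif_component: "t \<in> I \<Longrightarrow> (\<lambda>x. x t) \<in> borel_measurable (\<Pi>\<^sub>M t\<in>I. unif)"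
  using measurable_component_singleton[of t I "\<lambda>_. unif"]
  by (simp add: measurable_cong_sets[OF refl sets_unif])

lemma prob_space_future_law: "prob_space (future_law T n)"
  by (intro prob_space_PiM prob_space_unif)

lemma AE_future_law: "AE x in future_law T n. \<forall>t\<in>{T - n<..T}. x t \<in> {0<..<1}"
  by (intro AE_finite_allI AE_PiM_component[where P = "\<lambda>u. u \<in> {0<..<1}"] prob_space_unif AE_unif) auto

lemma measurable_cutoff_future_law:
  "n \<le> T \<Longrightarrow> {T - n<..T} \<subseteq> I \<Longrightarrow> (\<lambda>x. cutoff T x n b) \<in> borel_measurable (\<Pi>\<^sub>M t\<in>I. unif)"
  by (intro measurable_cutoff measurable_unif_component) auto

lemma cutoff_bounds_AE: "n \<le> T \<Longrightarrow> AE x in future_law T n. cutoff T x n b \<in> {0..1}"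
  by (rule eventually_mono[OF AE_future_law])
    (intro cutoff_bounds, auto simp: less_imp_le)

lemma integrable_cutoff_power: "n \<le> T \<Longrightarrow> integrable (future_law T n) (\<lambda>x. cutoff T x n b ^ k)"
proof -
  assume n: "n \<le> T"
  interpret P: prob_space "future_law T n" by (rule prob_space_future_law)
  have "AE x in future_law T n. norm (cutoff T x n b ^ k) \<le> 1"
    using cutoff_bounds_AE[OF n, of b] by eventually_elim (auto simp: power_le_one)
  moreover have "(\<lambda>x. cutoff T x n b ^ k) \<in> borel_measurable (future_law T n)"
    using measurable_cutoff_future_law[OF n order_refl, of b] by measurable
  ultimately show ?thesis by (intro P.integrable_const_bound[of _ 1])
qed

text \<open>
  The induction step for the moments of the cutoff. Truncated subtraction is intended: for
  \<open>a = 0\<close> the cutoff is \<open>0\<close> and both sides are the powers of \<open>0\<close>.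
\<close>
lemma pochhammer_moment_recursion:
  fixes a N :: nat
  assumes "0 < N"
  shows "pochhammer (real a) k / pochhammer (real (Suc N)) k =
    pochhammer (real a) k / pochhammer (real N) k -
      real k / (real k + 1) * (pochhammer (real a) (k + 1) / pochhammer (real N) (k + 1) -
        pochhammer (real (a - 1)) (k + 1) / pochhammer (real N) (k + 1))"
proof -
  have pos: "0 < pochhammer (real N) k" "0 < pochhammer (real (Suc N)) k"
    using assms by (auto intro: pochhammer_pos)
  have N: "pochhammer (real N) (k + 1) = real N * pochhammer (real (Suc N)) k"
    by (simp add: pochhammer_rec add.commute)
  have N': "pochhammer (real N) (k + 1) = pochhammer (real N) k * (real N + real k)"
    by (simp add: pochhammer_Suc)
  have "pochhammer (real a) (k + 1) - pochhammer (real (a - 1)) (k + 1) = (real k + 1) * pochhammer (real a) k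
      \<or> a = 0 \<and> pochhammer (real a) (k + 1) = 0"
  proof (cases a)
    case (Suc c)
    have "pochhammer (real c) (k + 1) = real c * pochhammer (real a) k"
      by (simp add: pochhammer_rec Suc add.commute)
    moreover have "pochhammer (real a) (k + 1) = pochhammer (real a) k * (real a + real k)"
      by (simp add: pochhammer_Suc)
    ultimately show ?thesis by (simp add: Suc algebra_simps)
  qed (simp add: pochhammer_0_left)
  then show ?thesis
  proof
    assume *: "pochhammer (real a) (k + 1) - pochhammer (real (a - 1)) (k + 1) = (real k + 1) * pochhammer (real a) k"
    have "pochhammer (real a) k / pochhammer (real N) k -
      real k / (real k + 1) * (pochhammer (real a) (k + 1) / pochhammer (real N) (k + 1) -
        pochhammer (real (a - 1)) (k + 1) / pochhammer (real N) (k + 1)) =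
      pochhammer (real a) k / pochhammer (real N) k -
        real k / (real k + 1) * ((real k + 1) * pochhammer (real a) k / pochhammer (real N) (k + 1))"
      by (simp only: diff_divide_distrib[symmetric] *)
    also have "\<dots> = pochhammer (real a) k * real N / (pochhammer (real N) k * (real N + real k))"
      unfolding N' using pos assms by (simp add: divide_simps) (simp add: algebra_simps)
    also have "\<dots> = pochhammer (real a) k / pochhammer (real (Suc N)) k"
      unfolding N'[symmetric] N using assms by simp
    finally show ?thesis ..
  next
    assume "a = 0 \<and> pochhammer (real a) (k + 1) = 0"
    then show ?thesis by (cases k) (auto simp: pochhammer_0_left)
  qed
qed

lemma product_sigma_finite_unif: "product_sigma_finite (\<lambda>_. unif)"
  using prob_space_unif by (simp add: product_sigma_finite_def prob_space_imp_sigma_finite)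

text \<open>
  For \<open>1 \<le> b \<le> n\<close> the moments of the Beta law with parameters \<open>n + 1 - b\<close> and \<open>b\<close>. A step of the recursion
  expresses the \<open>k\<close>-th moment by \<open>k\<close>-th and \<open>(k + 1)\<close>-th moments for one variable less, so the
  induction has to treat all \<open>k\<close> together.
\<close>
lemma cutoff_moment:
  assumes "n \<le> T"
  shows "(\<integral>x. cutoff T x n b ^ k \<partial>future_law T n) =
    pochhammer (real (n + 1 - b)) k / pochhammer (real (n + 1)) k"
  using assms
proof (induction n arbitrary: b k)
  case 0
  interpret P: prob_space "future_law T 0" by (rule prob_space_future_law)
  have "pochhammer (1::real) k \<noteq> 0" by (simp add: pochhammer_fact[symmetric])
  then show ?case using P.prob_space by (cases b) (auto simp: pochhammer_0_left power_0_left)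
next
  case (Suc n)
  interpret E: product_sigma_finite "\<lambda>_::nat. unif" by (rule product_sigma_finite_unif)
  interpret P: prob_space "future_law T (Suc n)" by (rule prob_space_future_law)
  have n: "n < T" "n \<le> T" using Suc.prems by auto
  have pos: "pochhammer (2 + real n) k \<noteq> 0" using pochhammer_pos[of "2 + real n" k] by simp
  show ?case
  proof (cases b)
    case 0
    then show ?thesis using P.prob_space pos by (simp add: add.commute)
  next
    case b: (Suc b')
    note I = future_insert[OF n(1)]
    have fin: "finite {T - n<..T}" "T - n \<notin> {T - n<..T}" by auto
    have "(\<integral>x. cutoff T x (Suc n) b ^ k \<partial>future_law T (Suc n)) =
        (\<integral>x. (\<integral>u. cutoff T (x(T - n := u)) (Suc n) b ^ k \<partial>unif) \<partial>future_law T n)"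
      using E.product_integral_insert[OF fin] integrable_cutoff_power[OF Suc.prems] unfolding I by blast
    also have "\<dots> = (\<integral>x. cutoff T x n b' ^ k - real k / (real k + 1) * (cutoff T x n b' ^ (k + 1) - cutoff T x n b ^ (k + 1)) \<partial>future_law T n)"
    proof (rule integral_cong_AE)
      have upd: "cutoff T (x(T - n := u)) n b'' = cutoff T x n b''" for x u b''
        using n by (intro cutoff_cong) auto
      show "AE x in future_law T n. (\<integral>u. cutoff T (x(T - n := u)) (Suc n) b ^ k \<partial>unif) =
          cutoff T x n b' ^ k - real k / (real k + 1) * (cutoff T x n b' ^ (k + 1) - cutoff T x n b ^ (k + 1))"
      proof (rule eventually_mono[OF AE_future_law])
        fix x :: "nat \<Rightarrow> real" assume "\<forall>t\<in>{T - n<..T}. x t \<in> {0<..<1}"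
        then have x: "\<And>t. t \<in> {T - n<..T} \<Longrightarrow> x t \<in> {0..1}" by (auto simp: less_imp_le)
        have "(\<integral>u. max (cutoff T x n b) (min u (cutoff T x n b')) ^ k \<partial>unif) = 
          cutoff T x n b' ^ k - real k / (real k + 1) * (cutoff T x n b' ^ (k + 1) - cutoff T x n b ^ (k + 1))"
          using cutoff_bounds[OF n(2) x, where b = b] cutoff_bounds[OF n(2) x, where b = b'] cutoff_decreasing[OF n(2) x, where b = b']
          by (intro integral_unif_clamp_power) (auto simp: b)
        then show "(\<integral>u. cutoff T (x(T - n := u)) (Suc n) b ^ k \<partial>unif) =
          cutoff T x n b' ^ k - real k / (real k + 1) * (cutoff T x n b' ^ (k + 1) - cutoff T x n b ^ (k + 1))"
          by (simp add: b upd)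
      qed
      have [measurable]: "(\<lambda>x. cutoff T x n b'') \<in> borel_measurable (future_law T n)" for b''
        using n by (intro measurable_cutoff_future_law) auto
      show "(\<lambda>x. cutoff T x n b' ^ k - real k / (real k + 1) * (cutoff T x n b' ^ (k + 1) - cutoff T x n b ^ (k + 1)))
          \<in> borel_measurable (future_law T n)" by measurable
      have [measurable]: "(\<lambda>x. cutoff T x (Suc n) b) \<in> borel_measurable (\<Pi>\<^sub>M t\<in>insert (T - n) {T - n<..T}. unif)"
        using measurable_cutoff_future_law[OF Suc.prems order_refl] unfolding I .
      have "(\<lambda>(x, u). cutoff T (x(T - n := u)) (Suc n) b ^ k) \<in> borel_measurable (future_law T n \<Otimes>\<^sub>M unif)"
        by measurable
      then show "(\<lambda>x. \<integral>u. cutoff T (x(T - n := u)) (Suc n) b ^ k \<partial>unif) \<in> borel_measurable (future_law T n)"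
        by (intro sigma_finite_measure.borel_measurable_lebesgue_integral
              prob_space_imp_sigma_finite prob_space_unif)
    qed
    also have "\<dots> = pochhammer (real (n + 1 - b')) k / pochhammer (real (n + 1)) k -
      real k / (real k + 1) * (pochhammer (real (n + 1 - b')) (k + 1) / pochhammer (real (n + 1)) (k + 1) -
        pochhammer (real (n + 1 - b)) (k + 1) / pochhammer (real (n + 1)) (k + 1))"
      using integrable_cutoff_power[OF n(2)] by (simp only: Bochner_Integration.integral_diff
        Bochner_Integration.integrable_diff integrable_mult_right integral_mult_right_zero Suc.IH[OF n(2)])
    also have "\<dots> = pochhammer (real (Suc n + 1 - b)) k / pochhammer (real (Suc n + 1)) k"
      using pochhammer_moment_recursion[of "n + 1" "n + 1 - b'" k] by (simp add: b)
    finally show ?thesis .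
  qed
qed

text \<open>
  The number subtracted from the cutoff is the threshold of the policy. It is also the mean of the
  cutoff, so the integral is a variance.
\<close>
lemma cutoff_variance_le:
  assumes "n \<le> T" "b \<le> n + 1"
  shows "(\<integral>x. (cutoff T x n b - (1 - real b / (real n + 1)))\<^sup>2 \<partial>future_law T n) \<le> 1 / (real n + 1)"
proof -
  interpret P: prob_space "future_law T n" by (rule prob_space_future_law)
  define N a where "N = real n + 1" and "a = real n + 1 - real b"
  have N: "1 \<le> N" and a: "0 \<le> a" "a \<le> N" using assms(2) by (auto simp: N_def a_def)
  have p: "1 - real b / (real n + 1) = a / N" by (simp add: a_def N_def field_simps)
  have ra: "real (n + 1 - b) = a" using assms(2) by (simp add: a_def of_nat_diff)
  have m1: "(\<integral>x. cutoff T x n b \<partial>future_law T n) = a / N"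
    using cutoff_moment[OF assms(1), of b 1] ra by (simp add: N_def add.commute)
  have m2: "(\<integral>x. (cutoff T x n b)\<^sup>2 \<partial>future_law T n) = a * (a + 1) / (N * (N + 1))"
    using cutoff_moment[OF assms(1), of b 2] ra
    by (simp add: N_def add.commute numeral_2_eq_2 pochhammer_Suc)
  have i1: "integrable (future_law T n) (\<lambda>x. cutoff T x n b)"
    using integrable_cutoff_power[OF assms(1), of b 1] by simp
  note i2 = integrable_cutoff_power[OF assms(1), of b 2]
  have "(\<integral>x. (cutoff T x n b - a / N)\<^sup>2 \<partial>future_law T n) =
      (\<integral>x. (cutoff T x n b)\<^sup>2 - 2 * (a / N) * cutoff T x n b + (a / N)\<^sup>2 \<partial>future_law T n)"
    by (simp add: power2_diff algebra_simps)
  also have "\<dots> = a * (a + 1) / (N * (N + 1)) - 2 * (a / N) * (a / N) + (a / N)\<^sup>2"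
    using i1 i2 P.prob_space by (simp add: m1 m2)
  also have "\<dots> = a * (N - a) / (N\<^sup>2 * (N + 1))"
    using N by (simp add: divide_simps power2_eq_square) (simp add: algebra_simps)
  also have "\<dots> \<le> N * N / (N\<^sup>2 * N)"
    using a N by (intro frac_le mult_mono mult_pos_pos) auto
  also have "\<dots> = 1 / N" by (simp add: power2_eq_square)
  finally show ?thesis unfolding p by (simp add: N_def)
qed
text \<open>
  A substitute for Jensen's inequality that loses a factor of \<open>2\<close> after integration when \<open>\<sigma>\<^sup>2\<close> bounds
  the second moment: below \<open>\<sigma>\<close> the constant term dominates, above it the square does.
\<close>
lemma powr_le_quadratic:
  fixes z \<sigma> \<gamma> :: real
  assumes "0 \<le> z" "0 < \<sigma>" "0 \<le> \<gamma>" "\<gamma> \<le> 2"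
  shows "z powr \<gamma> \<le> \<sigma> powr \<gamma> * (1 + (z / \<sigma>)\<^sup>2)"
proof -
  have "(z / \<sigma>) powr \<gamma> \<le> 1 + (z / \<sigma>)\<^sup>2"
  proof (cases "z \<le> \<sigma>")
    case True
    then have "(z / \<sigma>) powr \<gamma> \<le> 1" using assms by (intro powr_le1) auto
    then show ?thesis by (rule order_trans) simp
  next
    case False
    then have "(z / \<sigma>) powr \<gamma> \<le> (z / \<sigma>) powr 2" using assms by (intro powr_mono) auto
    also have "\<dots> = (z / \<sigma>)\<^sup>2" using False assms by simp
    finally show ?thesis by simp
  qed
  moreover have "z powr \<gamma> = \<sigma> powr \<gamma> * (z / \<sigma>) powr \<gamma>"
    using assms by (simp add: powr_divide)
  ultimately show ?thesis by (simp add: mult_left_mono)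
qed

lemma cutoff_deviation_le:
  assumes "n \<le> T" "b \<le> n + 1" "0 \<le> \<gamma>" "\<gamma> \<le> 2"
  shows "(\<integral>\<^sup>+x. ennreal (\<bar>cutoff T x n b - (1 - real b / (real n + 1))\<bar> powr \<gamma>) \<partial>future_law T n)
    \<le> ennreal (2 * (real n + 1) powr (- (\<gamma> / 2)))"
proof -
  interpret P: prob_space "future_law T n" by (rule prob_space_future_law)
  define N where "N = real n + 1"
  let ?p = "1 - real b / (real n + 1)"
  let ?z = "\<lambda>x. cutoff T x n b - ?p"
  have N: "1 \<le> N" by (simp add: N_def)
  have [measurable]: "(\<lambda>x. cutoff T x n b) \<in> borel_measurable (future_law T n)"
    using assms by (intro measurable_cutoff_future_law) auto
  have le: "\<bar>?z x\<bar> powr \<gamma> \<le> N powr (- (\<gamma> / 2)) * (1 + N * (?z x)\<^sup>2)" for x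
  proof -
    have "(1 / sqrt N) powr \<gamma> = N powr (- (\<gamma> / 2))"
      using N by (simp add: powr_half_sqrt[symmetric] powr_divide powr_powr powr_minus_divide)
    moreover have "(\<bar>?z x\<bar> / (1 / sqrt N))\<^sup>2 = N * (?z x)\<^sup>2"
      using N by (simp add: power_mult_distrib)
    ultimately show ?thesis
      using powr_le_quadratic[of "\<bar>?z x\<bar>" "1 / sqrt N" \<gamma>] assms N by simp
  qed
  have "integrable (future_law T n) (\<lambda>x. (cutoff T x n b)\<^sup>2 - 2 * ?p * cutoff T x n b + ?p\<^sup>2)"
    using integrable_cutoff_power[OF assms(1), of b 2] integrable_cutoff_power[OF assms(1), of b 1]
    by (intro Bochner_Integration.integrable_add Bochner_Integration.integrable_diff
        integrable_mult_right) auto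
  also have "(\<lambda>x. (cutoff T x n b)\<^sup>2 - 2 * ?p * cutoff T x n b + ?p\<^sup>2) = (\<lambda>x. (?z x)\<^sup>2)"
    by (intro ext) (simp only: power2_diff, simp)
  finally have int: "integrable (future_law T n) (\<lambda>x. (?z x)\<^sup>2)" .
  have "(\<integral>\<^sup>+x. ennreal (\<bar>?z x\<bar> powr \<gamma>) \<partial>future_law T n) \<le>
      (\<integral>\<^sup>+x. ennreal (N powr (- (\<gamma> / 2)) * (1 + N * (?z x)\<^sup>2)) \<partial>future_law T n)"
    by (intro nn_integral_mono ennreal_leI le)
  also have "\<dots> = ennreal (\<integral>x. N powr (- (\<gamma> / 2)) * (1 + N * (?z x)\<^sup>2) \<partial>future_law T n)"
    using int N by (intro nn_integral_eq_integral) auto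
  also have "(\<integral>x. N powr (- (\<gamma> / 2)) * (1 + N * (?z x)\<^sup>2) \<partial>future_law T n) =
      N powr (- (\<gamma> / 2)) * (1 + N * (\<integral>x. (?z x)\<^sup>2 \<partial>future_law T n))"
    using int P.prob_space by simp
  also have "\<dots> \<le> N powr (- (\<gamma> / 2)) * (1 + N * (1 / N))"
    using cutoff_variance_le[OF assms(1,2)] N
    by (intro mult_left_mono add_left_mono) (auto simp: N_def)
  also have "\<dots> = 2 * N powr (- (\<gamma> / 2))" using N by simp
  finally show ?thesis by (simp add: N_def ennreal_leI)
qed

section \<open>Expected regret for a Hoelder continuous quantile function\<close>

locale hoelder_quantile =
  fixes Q :: "real \<Rightarrow> real" and C s :: real
  assumes Q_mono: "mono_on {0..1} Q" and Q_0: "Q 0 = 0"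
    and Q_measurable [measurable]: "Q \<in> borel_measurable borel"
    and C_nonneg: "0 \<le> C" and s: "0 \<le> s" "s \<le> 1"
    and Hoelder: "\<And>q q'. q \<in> {0<..1} \<Longrightarrow> q' \<in> {0<..1} \<Longrightarrow> \<bar>Q q - Q q'\<bar> \<le> C * \<bar>q - q'\<bar> powr s"
begin

definition loss_bound :: "nat \<Rightarrow> real" where
  "loss_bound n = (if n = 0 then 0 else 2 * C * (real n + 1) powr (- ((1 + s) / 2)))"

lemma loss_bound_nonneg: "0 \<le> loss_bound n"
  using C_nonneg by (simp add: loss_bound_def)

lemma Q_nonneg: "q \<in> {0..1} \<Longrightarrow> 0 \<le> Q q"
  using mono_onD[OF Q_mono, of 0 q] Q_0 by auto

lemma measurable_path_regret:
  assumes "n \<le> T" "{T - n<..T} \<subseteq> I"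
  shows "path_regret T Q n b \<in> borel_measurable (\<Pi>\<^sub>M t\<in>I. unif)"
proof -
  have x: "(\<lambda>x. x t) \<in> borel_measurable (\<Pi>\<^sub>M t\<in>I. unif)" if "t \<in> {T - n<..T}" for t
    using that assms by (intro measurable_unif_component) auto
  then have Qx: "(\<lambda>x. Q (x t)) \<in> borel_measurable (\<Pi>\<^sub>M t\<in>I. unif)" if "t \<in> {T - n<..T}" for t
    using that by measurable
  show ?thesis unfolding path_regret_def
    using measurable_best_value[OF assms(1) Qx, where b = b]
      measurable_cwg_value[OF assms(1) Qx x, where b = b] by measurable
qed

lemma measurable_cwg_loss:
  assumes "n < T"
  shows "cwg_loss T Q n b \<in> borel_measurable (\<Pi>\<^sub>M t\<in>insert (T - n) {T - n<..T}. unif)"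
proof -
  let ?M = "\<Pi>\<^sub>M t\<in>insert (T - n) {T - n<..T}. unif"
  have [measurable]: "(\<lambda>x. cutoff T x n b) \<in> borel_measurable ?M"
    using assms by (intro measurable_cutoff_future_law) auto
  have [measurable]: "(\<lambda>x. x (T - n)) \<in> borel_measurable ?M"
    by (intro measurable_unif_component) auto
  show ?thesis unfolding cwg_loss_def cwg_accepts_def by measurable
qed

lemma emeasure_unif_between_le: "emeasure unif {min p y..max p y} \<le> ennreal \<bar>y - p\<bar>"
proof -
  have "emeasure unif {min p y..max p y} = emeasure lborel ({0<..<1} \<inter> {min p y..max p y})"
    by (rule emeasure_unif) simp
  also have "\<dots> \<le> emeasure lborel {min p y..max p y}"
    by (rule emeasure_mono) auto
  also have "\<dots> = ennreal \<bar>y - p\<bar>" by (simp add: max_def min_def abs_if)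
  finally show ?thesis .
qed

text \<open>
  The current quantile is integrated first, with the future fixed: it falls between threshold and
  cutoff with probability at most their distance, which raises the exponent from \<open>s\<close> to \<open>1 + s\<close>.
\<close>
lemma expected_cwg_loss_le:
  assumes "n < T" "b \<le> n + 1"
  shows "(\<integral>\<^sup>+x. ennreal (cwg_loss T Q n b x) \<partial>future_law T (Suc n)) \<le> ennreal (loss_bound n)"
proof (cases "b \<in> {1..n}")
  case False
  with assms have b: "b \<in> {0, Suc n}" by auto
  have "AE x in future_law T (Suc n). ennreal (cwg_loss T Q n b x) = 0"
    by (rule eventually_mono[OF AE_future_law]) (use cwg_loss_eq_0[OF Q_mono Q_0 assms(1) _ b] in simp)
  then have "(\<integral>\<^sup>+x. ennreal (cwg_loss T Q n b x) \<partial>future_law T (Suc n)) = (\<integral>\<^sup>+x. 0 \<partial>future_law T (Suc n))"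
    by (rule nn_integral_cong_AE)
  then show ?thesis by simp
next
  case True
  interpret E: product_sigma_finite "\<lambda>_::nat. unif" by (rule product_sigma_finite_unif)
  let ?p = "1 - real b / (real n + 1)"
  note I = future_insert[OF assms(1)]
  have fin: "finite {T - n<..T}" "T - n \<notin> {T - n<..T}" by auto
  have [measurable]: "(\<lambda>x. cutoff T x n b) \<in> borel_measurable (future_law T n)"
    using assms by (intro measurable_cutoff_future_law) auto
  note [measurable] = measurable_cwg_loss[OF assms(1), of b]
  have "(\<integral>\<^sup>+x. ennreal (cwg_loss T Q n b x) \<partial>future_law T (Suc n)) =
      (\<integral>\<^sup>+x. (\<integral>\<^sup>+u. ennreal (cwg_loss T Q n b (x(T - n := u))) \<partial>unif) \<partial>future_law T n)"
    unfolding I by (intro E.product_nn_integral_insert fin) measurable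
  also have "\<dots> \<le> (\<integral>\<^sup>+x. ennreal C * ennreal (\<bar>cutoff T x n b - ?p\<bar> powr (1 + s)) \<partial>future_law T n)"
  proof (rule nn_integral_mono_AE, rule eventually_mono[OF AE_future_law])
    fix x :: "nat \<Rightarrow> real" assume x: "\<forall>t\<in>{T - n<..T}. x t \<in> {0<..<1}"
    let ?y = "cutoff T x n b"
    have upd: "cutoff T (x(T - n := u)) n b = ?y" for u
      using assms by (intro cutoff_cong) auto
    have "(\<integral>\<^sup>+u. ennreal (cwg_loss T Q n b (x(T - n := u))) \<partial>unif) \<le>
        (\<integral>\<^sup>+u. ennreal (C * \<bar>?y - ?p\<bar> powr s) * indicator {min ?p ?y..max ?p ?y} u \<partial>unif)"
    proof (rule nn_integral_mono_AE, rule eventually_mono[OF AE_unif])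
      fix u :: real assume u: "u \<in> {0<..<1}"
      have "(x(T - n := u)) t \<in> {0<..<1}" if "t \<in> {T - Suc n<..T}" for t
        using that u x unfolding I by auto
      then have "cwg_loss T Q n b (x(T - n := u)) \<le> C * \<bar>?y - ?p\<bar> powr s * indicator {min ?p ?y..max ?p ?y} u"
        using cwg_loss_le[OF Q_mono Q_0 Hoelder C_nonneg s(1) assms(1) _ True, of "x(T - n := u)"]
        by (simp add: upd)
      then show "ennreal (cwg_loss T Q n b (x(T - n := u))) \<le>
          ennreal (C * \<bar>?y - ?p\<bar> powr s) * indicator {min ?p ?y..max ?p ?y} u"
        using C_nonneg by (auto simp: indicator_def ennreal_leI ennreal_neg split: if_splits)
    qed
    also have "\<dots> = ennreal (C * \<bar>?y - ?p\<bar> powr s) * emeasure unif {min ?p ?y..max ?p ?y}"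
      by (intro nn_integral_cmult_indicator) simp
    also have "\<dots> \<le> ennreal (C * \<bar>?y - ?p\<bar> powr s) * ennreal \<bar>?y - ?p\<bar>"
      by (intro mult_left_mono emeasure_unif_between_le) simp
    also have "\<dots> = ennreal C * ennreal (\<bar>?y - ?p\<bar> powr (1 + s))"
      using C_nonneg by (simp add: ennreal_mult[symmetric] powr_add mult_ac)
    finally show "(\<integral>\<^sup>+u. ennreal (cwg_loss T Q n b (x(T - n := u))) \<partial>unif) \<le>
        ennreal C * ennreal (\<bar>?y - ?p\<bar> powr (1 + s))" .
  qed
  also have "\<dots> = ennreal C * (\<integral>\<^sup>+x. ennreal (\<bar>cutoff T x n b - ?p\<bar> powr (1 + s)) \<partial>future_law T n)"
    by (intro nn_integral_cmult) measurable
  also have "\<dots> \<le> ennreal C * ennreal (2 * (real n + 1) powr (- ((1 + s) / 2)))"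
    using assms s by (intro mult_left_mono cutoff_deviation_le) auto
  also have "\<dots> = ennreal (loss_bound n)"
    using True C_nonneg by (simp add: loss_bound_def ennreal_mult[symmetric] mult_ac)
  finally show ?thesis .
qed

text \<open>
  The budget after the current period depends on the current quantile only, which is independent of
  the future. Fixing this quantile first, the induction hypothesis applies to whichever budget
  results, because its bound does not depend on the budget.
\<close>
lemma expected_path_regret_le:
  assumes "n \<le> T" "b \<le> n"
  shows "(\<integral>\<^sup>+x. ennreal (path_regret T Q n b x) \<partial>future_law T n) \<le> ennreal (\<Sum>m<n. loss_bound m)"
  using assms
proof (induction n arbitrary: b)
  case 0
  then show ?case by (simp add: path_regret_def)
next
  case (Suc n)
  interpret E: product_sigma_finite "\<lambda>_::nat. unif" by (rule product_sigma_finite_unif)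
  interpret U: prob_space unif by (rule prob_space_unif)
  have n: "n < T" "n \<le> T" using Suc.prems by auto
  note I = future_insert[OF n(1)]
  have fin: "finite {T - n<..T}" "T - n \<notin> {T - n<..T}" by auto
  let ?M = "\<Pi>\<^sub>M t\<in>insert (T - n) {T - n<..T}. unif"
  let ?L = "cwg_loss T Q n b"
  let ?R = "\<lambda>x. if cwg_accepts T (T - n) b (x (T - n)) then path_regret T Q n (b - 1) x
     else path_regret T Q n b x"
  have [measurable]: "?L \<in> borel_measurable ?M" by (rule measurable_cwg_loss[OF n(1)])
  have [measurable]: "path_regret T Q n b' \<in> borel_measurable ?M" for b'
    using n by (intro measurable_path_regret) auto
  have [measurable]: "(\<lambda>x. x (T - n)) \<in> borel_measurable ?M"
    by (intro measurable_unif_component) auto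
  have R [measurable]: "?R \<in> borel_measurable ?M"
    unfolding cwg_accepts_def by measurable
  have "(\<integral>\<^sup>+x. ennreal (path_regret T Q (Suc n) b x) \<partial>future_law T (Suc n)) \<le>
      (\<integral>\<^sup>+x. ennreal (?L x) + ennreal (?R x) \<partial>future_law T (Suc n))"
  proof (rule nn_integral_mono_AE, rule eventually_mono[OF AE_future_law])
    fix x :: "nat \<Rightarrow> real" assume x: "\<forall>t\<in>{T - Suc n<..T}. x t \<in> {0<..<1}"
    have "path_regret T Q (Suc n) b x = ?L x + ?R x"
      using n x by (intro path_regret_Suc[OF Q_mono Q_0]) (auto simp: I less_imp_le)
    moreover have "0 \<le> ?L x" by (simp add: cwg_loss_def)
    moreover have "0 \<le> path_regret T Q n b' x" for b'
      unfolding path_regret_def using n x Q_nonneg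
      by (simp, intro cwg_value_le_best_value) (auto simp: I less_imp_le)
    ultimately show "ennreal (path_regret T Q (Suc n) b x) \<le> ennreal (?L x) + ennreal (?R x)"
      by (simp add: ennreal_plus[symmetric] del: ennreal_plus)
  qed
  also have "\<dots> = (\<integral>\<^sup>+x. ennreal (?L x) \<partial>future_law T (Suc n)) + (\<integral>\<^sup>+x. ennreal (?R x) \<partial>future_law T (Suc n))"
    unfolding I by (rule nn_integral_add) measurable
  also have "(\<integral>\<^sup>+x. ennreal (?R x) \<partial>future_law T (Suc n)) =
      (\<integral>\<^sup>+u. (\<integral>\<^sup>+x. ennreal (?R (x(T - n := u))) \<partial>future_law T n) \<partial>unif)"
    unfolding I by (intro E.product_nn_integral_insert_rev fin) measurable
  also have "\<dots> \<le> (\<integral>\<^sup>+u. ennreal (\<Sum>m<n. loss_bound m) \<partial>unif)"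
  proof (rule nn_integral_mono_AE, rule eventually_mono[OF AE_unif])
    fix u :: real assume u: "u \<in> {0<..<1}"
    define b' where "b' = (if cwg_accepts T (T - n) b u then b - 1 else b)"
    \<comment> \<open>A budget equal to the number of remaining periods is always spent, which keeps the budget
        within the range of the induction hypothesis.\<close>
    have "b' \<le> n"
    proof (cases "b = Suc n")
      case True
      have "cwg_threshold T (T - n) (Suc n) = 0"
        using n(1) by (simp add: cwg_threshold_eq field_simps)
      then have "cwg_accepts T (T - n) b u" using u True by (simp add: cwg_accepts_def)
      then show ?thesis by (simp add: b'_def True)
    qed (use Suc.prems in \<open>auto simp: b'_def\<close>)
    have "?R (x(T - n := u)) = path_regret T Q n b' x" for x
    proof -
      have "path_regret T Q n b'' (x(T - n := u)) = path_regret T Q n b'' x" for b''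
        unfolding path_regret_def using n
        by (intro arg_cong2[where f = "(-)"] best_value_cong cwg_value_cong) auto
      then show ?thesis by (simp add: b'_def)
    qed
    then show "(\<integral>\<^sup>+x. ennreal (?R (x(T - n := u))) \<partial>future_law T n) \<le> ennreal (\<Sum>m<n. loss_bound m)"
      using Suc.IH[OF n(2) \<open>b' \<le> n\<close>] by (simp only:)
  qed
  also have "\<dots> = ennreal (\<Sum>m<n. loss_bound m)" using U.emeasure_space_1 by simp
  also have "(\<integral>\<^sup>+x. ennreal (?L x) \<partial>future_law T (Suc n)) + ennreal (\<Sum>m<n. loss_bound m) \<le>
      ennreal (loss_bound n) + ennreal (\<Sum>m<n. loss_bound m)"
    using Suc.prems by (intro add_right_mono expected_cwg_loss_le n) auto
  also have "\<dots> = ennreal (\<Sum>m<Suc n. loss_bound m)"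
    by (simp add: ennreal_plus[symmetric] loss_bound_nonneg sum_nonneg add.commute del: ennreal_plus)
  finally show ?case by (simp add: add_mono)
qed

end

lemma (in hoelder_quantile) integral_path_regret_le:
  assumes "b \<le> T"
  shows "(\<integral>x. path_regret T Q T b x \<partial>future_law T T) \<le> (\<Sum>m<T. loss_bound m)"
proof -
  have "AE x in future_law T T. 0 \<le> path_regret T Q T b x"
  proof (rule eventually_mono[OF AE_future_law])
    fix x :: "nat \<Rightarrow> real" assume "\<forall>t\<in>{T - T<..T}. x t \<in> {0<..<1}"
    then show "0 \<le> path_regret T Q T b x"
      unfolding path_regret_def using Q_nonneg
      by (simp, intro cwg_value_le_best_value) (auto simp: less_imp_le)
  qed
  then have "(\<integral>x. path_regret T Q T b x \<partial>future_law T T) =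
      enn2real (\<integral>\<^sup>+x. ennreal (path_regret T Q T b x) \<partial>future_law T T)"
    using measurable_path_regret[of T T "{T - T<..T}" b] by (intro integral_eq_nn_integral) auto
  also have "\<dots> \<le> (\<Sum>m<T. loss_bound m)"
    using expected_path_regret_le[OF order_refl assms]
    by (intro enn2real_leI) (auto intro: sum_nonneg loss_bound_nonneg)
  finally show ?thesis .
qed

section \<open>The regret of the policy in the probability model\<close>

context unit_ability
begin

lemma sample_space_eq_distr:
  "sample_space D T = distr (\<Pi>\<^sub>M t\<in>{1..T}. unif) (\<Pi>\<^sub>M t\<in>{1..T}. borel \<Otimes>\<^sub>M borel)
     (compose {1..T} (\<lambda>u. (quantile D u, u)))"
proof -
  let ?f = "\<lambda>u. (quantile D u, u)"
  have "period_law D = distr unif (period_law D) ?f"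
    by (subst period_law_eq_distr, rule distr_cong) auto
  then have "sample_space D T = (\<Pi>\<^sub>M t\<in>{1..T}. distr unif (period_law D) ?f)"
    by (simp add: sample_space_def)
  also have "\<dots> = distr (\<Pi>\<^sub>M t\<in>{1..T}. unif) (\<Pi>\<^sub>M t\<in>{1..T}. period_law D) (compose {1..T} ?f)"
    by (rule distr_PiM_finite_prob_space'[symmetric])
      (auto intro: prob_space_unif prob_space_period_law)
  also have "\<dots> = distr (\<Pi>\<^sub>M t\<in>{1..T}. unif) (\<Pi>\<^sub>M t\<in>{1..T}. borel \<Otimes>\<^sub>M borel) (compose {1..T} ?f)"
    by (intro distr_cong sets_PiM_cong refl sets_period_law)
  finally show ?thesis .
qed

text \<open>
  Both expectations are carried over to the product of uniform laws, where the reward of the policy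
  and an upper bound for the hindsight reward are given by the backward recursions.
\<close>
lemma cwg_regret_le_path_regret:
  "cwg_regret D B T \<le> (\<integral>x. path_regret T (quantile D) T B x \<partial>future_law T T)"
proof -
  let ?S = "sample_space D T" and ?Q = "quantile D" and ?U = "\<Pi>\<^sub>M t\<in>{1..T}. unif"
  let ?N = "(\<Pi>\<^sub>M t\<in>{1..T}. borel \<Otimes>\<^sub>M borel) :: (nat \<Rightarrow> real \<times> real) measure"
  let ?h = "compose {1..T} (\<lambda>u. (?Q u, u))"
  let ?V = "\<lambda>\<omega>. best_value T (\<lambda>t. ability t \<omega>) T B"
  let ?W = "\<lambda>\<omega>. cwg_value T (\<lambda>t. ability t \<omega>) (\<lambda>t. drawn_quantile t \<omega>) T B"
  have I: "{1..T} = {T - T<..T}" by auto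
  have U_eq: "?U = future_law T T" by (simp only: I)
  interpret U: prob_space ?U unfolding U_eq by (rule prob_space_future_law)
  have h [measurable]: "?h \<in> measurable ?U ?N"
    unfolding compose_def
  proof (rule measurable_restrict)
    fix t assume "t \<in> {1..T}"
    then have [measurable]: "(\<lambda>x. x t) \<in> borel_measurable ?U" by (rule measurable_unif_component)
    show "(\<lambda>x. (?Q (x t), x t)) \<in> measurable ?U (borel \<Otimes>\<^sub>M borel)" by measurable
  qed
  have comp: "(\<lambda>\<omega>. ability t \<omega>) \<in> borel_measurable ?N" "(\<lambda>\<omega>. drawn_quantile t \<omega>) \<in> borel_measurable ?N"
    if "t \<in> {T - T<..T}" for t
    using measurable_component_singleton[of t "{1..T}" "\<lambda>_. borel \<Otimes>\<^sub>M borel :: (real \<times> real) measure"] that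
    unfolding ability_def drawn_quantile_def by (auto intro!: measurable_fst'' measurable_snd'')
  have V [measurable]: "?V \<in> borel_measurable ?N"
    by (rule measurable_best_value[OF order_refl comp(1)])
  have W [measurable]: "?W \<in> borel_measurable ?N"
    by (rule measurable_cwg_value[OF order_refl comp])
  have Vh: "?V (?h x) = best_value T (\<lambda>t. ?Q (x t)) T B" for x
    by (rule best_value_cong) (auto simp: ability_def compose_def)
  have Wh: "?W (?h x) = cwg_value T (\<lambda>t. ?Q (x t)) x T B" for x
    by (rule cwg_value_cong) (auto simp: ability_def drawn_quantile_def compose_def)
  have range: "AE x in ?U. \<forall>t\<in>{T - T<..T}. ?Q (x t) \<in> {0..1}"
    unfolding U_eq by (rule eventually_mono[OF AE_future_law]) (auto intro!: quantile_unit simp del: atLeastAtMost_iff)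
  have V_bound: "AE x in ?U. 0 \<le> ?V (?h x) \<and> norm (?V (?h x)) \<le> real T"
    using range unfolding Vh
  proof (rule eventually_mono)
    fix x assume "\<forall>t\<in>{T - T<..T}. ?Q (x t) \<in> {0..1}"
    then show "0 \<le> best_value T (\<lambda>t. ?Q (x t)) T B \<and> norm (best_value T (\<lambda>t. ?Q (x t)) T B) \<le> real T"
      using best_value_nonneg[of T T "\<lambda>t. ?Q (x t)" B] best_value_le[of T T "\<lambda>t. ?Q (x t)" B] by simp
  qed
  have W_bound: "AE x in ?U. norm (?W (?h x)) \<le> real T"
    using range unfolding Wh
  proof (rule eventually_mono)
    fix x assume "\<forall>t\<in>{T - T<..T}. ?Q (x t) \<in> {0..1}"
    then show "norm (cwg_value T (\<lambda>t. ?Q (x t)) x T B) \<le> real T"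
      using cwg_value_nonneg[of T T "\<lambda>t. ?Q (x t)" x B] cwg_value_le_best_value[of T T "\<lambda>t. ?Q (x t)" x B]
        best_value_le[of T T "\<lambda>t. ?Q (x t)" B] by simp
  qed
  have int_V: "integrable ?U (\<lambda>x. ?V (?h x))"
    using V_bound by (intro U.integrable_const_bound[of _ "real T"] measurable_compose[OF h V]) auto
  have int_W: "integrable ?U (\<lambda>x. ?W (?h x))"
    using W_bound by (intro U.integrable_const_bound[of _ "real T"] measurable_compose[OF h W])
  have "(\<integral>\<omega>. offline_reward T B (\<lambda>t. ability t \<omega>) \<partial>?S) \<le> (\<integral>\<omega>. ?V \<omega> \<partial>?S)"
  proof (rule integral_mono_AE')
    show "integrable ?S ?V"
      unfolding sample_space_eq_distr by (subst integrable_distr_eq[OF h V]) (rule int_V)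
    show "AE \<omega> in ?S. 0 \<le> ?V \<omega>"
      unfolding sample_space_eq_distr
    proof (subst AE_distr_iff[OF h])
      show "{\<omega> \<in> space ?N. 0 \<le> ?V \<omega>} \<in> sets ?N" by measurable
      show "AE x in ?U. 0 \<le> ?V (?h x)" using V_bound by (rule eventually_mono) simp
    qed
  qed (simp add: offline_reward_le_best_value)
  also have "(\<integral>\<omega>. ?V \<omega> \<partial>?S) = (\<integral>x. ?V (?h x) \<partial>?U)"
    unfolding sample_space_eq_distr by (rule integral_distr) measurable
  finally have offline: "(\<integral>\<omega>. offline_reward T B (\<lambda>t. ability t \<omega>) \<partial>?S) \<le> (\<integral>x. ?V (?h x) \<partial>?U)" .
  have "(\<Sum>t=1..T. ability t \<omega> * real (cwg_action T B t \<omega>)) = ?W \<omega>" for \<omega>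
  proof -
    have "(\<Sum>t=1..T. ability t \<omega> * real (cwg_action T B t \<omega>)) =
        (\<Sum>t\<in>{T - T<..T}. ability t \<omega> * of_bool (cwg_accepts T t
          (cwg_budget T B (\<lambda>s. drawn_quantile s \<omega>) t) (drawn_quantile t \<omega>)))"
      unfolding I by (intro sum.cong) (auto simp: cwg_action_def Let_def)
    also have "\<dots> = ?W \<omega>"
      by (subst cwg_reward_eq_cwg_value) auto
    finally show ?thesis .
  qed
  then have "(\<integral>\<omega>. (\<Sum>t=1..T. ability t \<omega> * real (cwg_action T B t \<omega>)) \<partial>?S) = (\<integral>\<omega>. ?W \<omega> \<partial>?S)"
    by simp
  also have "\<dots> = (\<integral>x. ?W (?h x) \<partial>?U)"
    unfolding sample_space_eq_distr by (rule integral_distr) measurable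
  finally have "cwg_regret D B T \<le> (\<integral>x. ?V (?h x) \<partial>?U) - (\<integral>x. ?W (?h x) \<partial>?U)"
    using offline by (simp add: cwg_regret_def regret_def)
  also have "\<dots> = (\<integral>x. ?V (?h x) - ?W (?h x) \<partial>?U)"
    using int_V int_W by simp
  also have "\<dots> = (\<integral>x. path_regret T ?Q T B x \<partial>future_law T T)"
    unfolding U_eq Vh Wh path_regret_def ..
  finally show ?thesis .
qed

end

section \<open>Power sums and the final bound\<close>

text \<open>
  Intervals of length at least \<open>1\<close> that partition \<open>(0, 1]\<close> leave room for a single one.
\<close>
lemma clustered_no_gaps:
  assumes "clustered \<beta> 1 0 C\<^sub>0 D" "q \<in> {0<..1}" "q' \<in> {0<..1}"
  shows "\<bar>quantile D q - quantile D q'\<bar> \<le> C\<^sub>0 * \<bar>q - q'\<bar> powr (1 / (\<beta> + 1))"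
proof -
  from assms(1) obtain n :: nat and qs where qs: "qs 0 = 0" "qs (n + 1) = 1"
    and step: "\<And>i. i \<in> {1..n + 1} \<Longrightarrow> qs i - qs (i - 1) \<ge> 1"
    and H: "\<And>i q q'. i \<in> {1..n + 1} \<Longrightarrow> q \<in> {qs (i - 1)<..qs i} \<Longrightarrow> q' \<in> {qs (i - 1)<..qs i} \<Longrightarrow>
       \<bar>quantile D q - quantile D q'\<bar> \<le> C\<^sub>0 * \<bar>q - q'\<bar> powr (1 / (\<beta> + 1)) + 0"
    unfolding clustered_def by blast
  have "real i \<le> qs i" if "i \<le> n + 1" for i
    using that
  proof (induction i)
    case (Suc i)
    then show ?case using step[of "Suc i"] by simp
  qed (simp add: qs)
  from this[of "n + 1"] have "n = 0" using qs by simp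
  then show ?thesis using H[of 1 q q'] qs assms(2,3) by simp
qed

text \<open>Comparison with an integral, in the form of a telescoping sum of increments of an antiderivative.\<close>
lemma sum_powr_minus_le:
  assumes "0 < a" "a < 1" "1 \<le> T"
  shows "(\<Sum>n\<in>{1..<T}. (real n + 1) powr (- a)) \<le> real T powr (1 - a) / (1 - a)"
proof -
  have increment: "(real n + 1) powr (- a) \<le> (real n + 1) powr (1 - a) / (1 - a) - real n powr (1 - a) / (1 - a)"
    if "1 \<le> n" for n :: nat
  proof -
    have "\<exists>z>real n. z < real n + 1 \<and>
      (real n + 1) powr (1 - a) / (1 - a) - real n powr (1 - a) / (1 - a) = (real n + 1 - real n) * z powr (- a)"
    proof (rule MVT2)
      fix z assume "real n \<le> z"
      then have "0 < z" using that by linarith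
      have "((\<lambda>z. z powr (1 - a) / (1 - a)) has_real_derivative (1 - a) * z powr (1 - a - 1) / (1 - a)) (at z)"
        by (intro DERIV_cdivide has_real_derivative_powr \<open>0 < z\<close>)
      then show "((\<lambda>z. z powr (1 - a) / (1 - a)) has_real_derivative z powr (- a)) (at z)"
        using assms by simp
    qed simp
    then obtain z where z: "real n < z" "z < real n + 1" and
      eq: "(real n + 1) powr (1 - a) / (1 - a) - real n powr (1 - a) / (1 - a) = z powr (- a)" by auto
    have "(real n + 1) powr (- a) \<le> z powr (- a)"
      using z that assms by (intro powr_mono2') auto
    then show ?thesis by (simp only: eq)
  qed
  have "(\<Sum>n\<in>{1..<T}. (real n + 1) powr (- a)) \<le>
      (\<Sum>n\<in>{1..<T}. real (Suc n) powr (1 - a) / (1 - a) - real n powr (1 - a) / (1 - a))"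
    using increment by (intro sum_mono) (auto simp: add.commute)
  also have "\<dots> = real T powr (1 - a) / (1 - a) - 1 / (1 - a)"
    using assms(3) by (subst sum_Suc_diff') auto
  also have "\<dots> \<le> real T powr (1 - a) / (1 - a)" using assms by simp
  finally show ?thesis .
qed

lemma sum_inverse_le_ln:
  assumes "1 \<le> T"
  shows "(\<Sum>n\<in>{1..<T}. (real n + 1) powr (- 1)) \<le> ln (real T)"
proof -
  have "(real n + 1) powr (- 1) \<le> ln (real (Suc n)) - ln (real n)" if "1 \<le> n" for n :: nat
    using that ln_diff_le[of "real n" "real n + 1"] by (simp add: powr_minus_divide add.commute)
  then have "(\<Sum>n\<in>{1..<T}. (real n + 1) powr (- 1)) \<le> (\<Sum>n\<in>{1..<T}. ln (real (Suc n)) - ln (real n))"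
    by (intro sum_mono) auto
  also have "\<dots> = ln (real T)"
    using assms by (subst sum_Suc_diff') auto
  finally show ?thesis .
qed

theorem corollary3:
  "\<forall>C\<^sub>0::real. \<exists>C::real. \<forall>(\<beta>::real) (D::real measure).
     \<beta> \<ge> 0 \<longrightarrow> real_distribution D \<longrightarrow> (AE \<theta> in D. \<theta> \<in> {0..1}) \<longrightarrow> clustered \<beta> 1 0 C\<^sub>0 D \<longrightarrow>
     (\<forall>(T::nat) (B::nat). B \<in> {1..T} \<longrightarrow>
        cwg_regret D B T
          \<le> C * (1 + 1 / \<beta>) * real T powr (1 / 2 - 1 / (2 * (1 + \<beta>))) * of_bool (\<beta> > 0)
            + C * ln (real T) * of_bool (\<beta> = 0))"
proof (intro allI exI impI)
  fix C\<^sub>0 \<beta> :: real and D :: "real measure" and T B :: nat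
  assume \<beta>: "\<beta> \<ge> 0" and D: "real_distribution D" "AE \<theta> in D. \<theta> \<in> {0..1}"
    and clustered: "clustered \<beta> 1 0 C\<^sub>0 D" and B: "B \<in> {1..T}"
  \<comment> \<open>The constant may be negative in the assumption; its positive part is a valid constant as well.\<close>
  let ?C = "max C\<^sub>0 0" and ?s = "1 / (\<beta> + 1)"
  define a where "a = (1 + ?s) / 2"
  interpret D: unit_ability D
    using D by (simp add: unit_ability_def unit_ability_axioms_def)
  interpret hoelder_quantile "quantile D" ?C ?s
  proof
    show "mono_on {0..1} (quantile D)" by (auto simp: mono_on_def intro: D.quantile_mono)
    show "\<bar>quantile D q - quantile D q'\<bar> \<le> ?C * \<bar>q - q'\<bar> powr ?s"
      if "q \<in> {0<..1}" "q' \<in> {0<..1}" for q q'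
      using clustered_no_gaps[OF clustered that]
      by (rule order_trans) (intro mult_right_mono, auto)
  qed (use \<beta> in \<open>auto simp: D.quantile_0\<close>)
  have T: "1 \<le> T" using B by auto
  have "cwg_regret D B T \<le> (\<Sum>m<T. loss_bound m)"
    using D.cwg_regret_le_path_regret[of B T] integral_path_regret_le[of B T] B by auto
  also have "\<dots> = (\<Sum>m\<in>{1..<T}. 2 * ?C * (real m + 1) powr (- a))"
    by (rule sum.mono_neutral_cong_right) (auto simp: loss_bound_def a_def)
  also have "\<dots> = 2 * ?C * (\<Sum>m\<in>{1..<T}. (real m + 1) powr (- a))"
    by (simp add: sum_distrib_left)
  finally have regret: "cwg_regret D B T \<le> 2 * ?C * (\<Sum>m\<in>{1..<T}. (real m + 1) powr (- a))" .
  show "cwg_regret D B T \<le> (4 * ?C) * (1 + 1 / \<beta>) * real T powr (1 / 2 - 1 / (2 * (1 + \<beta>))) * of_bool (\<beta> > 0)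
            + (4 * ?C) * ln (real T) * of_bool (\<beta> = 0)"
  proof (cases "\<beta> = 0")
    case True
    then have "a = 1" by (simp add: a_def)
    have "2 * ?C * (\<Sum>m\<in>{1..<T}. (real m + 1) powr (- a)) \<le> 2 * ?C * ln (real T)"
      unfolding \<open>a = 1\<close> using T by (intro mult_left_mono sum_inverse_le_ln) auto
    also have "\<dots> \<le> 4 * ?C * ln (real T)" using T by (intro mult_right_mono) auto
    finally show ?thesis using regret True by simp
  next
    case False
    with \<beta> have "0 < \<beta>" by simp
    then have a: "0 < a" "a < 1" and exponent: "1 - a = 1 / 2 - 1 / (2 * (1 + \<beta>))"
      and factor: "1 / (1 - a) = 2 * (1 + 1 / \<beta>)"
      by (auto simp: a_def field_simps)
    have "2 * ?C * (\<Sum>m\<in>{1..<T}. (real m + 1) powr (- a)) \<le> 2 * ?C * (real T powr (1 - a) / (1 - a))"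
      using T a by (intro mult_left_mono sum_powr_minus_le) auto
    also have "\<dots> = 2 * ?C * (real T powr (1 - a) * (1 / (1 - a)))" by simp
    also have "\<dots> = 4 * ?C * (1 + 1 / \<beta>) * real T powr (1 - a)" unfolding factor by simp
    finally show ?thesis using regret \<open>0 < \<beta>\<close> by (simp only: exponent) simp
  qed
qed

end
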